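(* Let $q$ be a prime and let $n,r,k$ be positive integers such that $k$ divides $r$ and $\frac rk$ divides $n$. Let $C_n=\langle\sigma\rangle$ be a cyclic group of order $n$, and let $\eta:C_n\to\mathrm{Aut}(\mathbb{F}_{q^r})$ be the action with $\eta(\sigma)=\varphi^k$, where $\varphi:x\mapsto x^q$ is the Frobenius automorphism of $\mathbb{F}_{q^r}$. Put $m:=\gcd(q^k-1,\frac{nk}{r})$ and $A_\eta:=\{1,\dots,m\}$, and for $a,b\in A_\eta$ define $a\sim_\eta b$ if and only if $aj\equiv b\pmod m$ for some integer $j$ which is prime to $n$ and satisfies $j\equiv1\pmod{\frac rk}$; this is an equivalence relation. Then there is a one-to-one correspondence between the Hamming isometry classes of the crossed products $(\mathbb{F}_{q^r})_\eta^f*C_n$, $f\in Z^2_\eta(C_n,\mathbb{F}_{q^r}^* )$, and the quotient set $A_\eta/\!\sim_\eta$.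
   Context: For a finite group $G$ acting on a commutative ring $R$ via $\eta:G\to\mathrm{Aut}(R)$ (write $g(r)=\eta(g)(r)$), $Z^2_\eta(G,R^* )$ denotes the 2-cocycles $f:G\times G\to R^*$, i.e. $f(g,h)f(gh,k)=g(f(h,k))f(g,hk)$. The crossed product $R_\eta^f*G$ is the associative ring which is a free left $R$-module with basis $\{u_g\}_{g\in G}$ and multiplication determined by $(\beta u_g)(\gamma u_h)=\beta\,g(\gamma)\,f(g,h)\,u_{gh}$ for $\beta,\gamma\in R$. The Hamming weight of $\sum_g\beta_gu_g$ is the number of $g$ with $\beta_g\ne0$. An isometry between two crossed products over $R$ is a bijective left $R$-linear ring homomorphism preserving the Hamming weights. Hamming isometry classes are the equivalence classes of crossed products (here with $R$, $G$ and $\eta$ fixed and $f$ varying) under the relation of existence of an isometry. *)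

theory Defs
  imports "HOL-Algebra.Algebra" "HOL-Number_Theory.Cong"
begin

text \<open>Automorphisms of a ring, built like \<open>auto\<close> and \<open>AutoGroup\<close> in the library: they are
  extensional on the carrier, and composition is the group operation.\<close>

definition ring_auto :: "('a, 'm) ring_scheme \<Rightarrow> ('a \<Rightarrow> 'a) set"
  where "ring_auto R = ring_hom R R \<inter> Bij (carrier R)"

definition RingAutoGroup :: "('a, 'm) ring_scheme \<Rightarrow> ('a \<Rightarrow> 'a) monoid"
  where "RingAutoGroup R = BijGroup (carrier R) \<lparr>carrier := ring_auto R\<rparr>"

definition frobenius_map :: "('a, 'm) ring_scheme \<Rightarrow> nat \<Rightarrow> 'a \<Rightarrow> 'a"
  where "frobenius_map R q = (\<lambda>x \<in> carrier R. x [^]\<^bsub>R\<^esub> q)"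

text \<open>The group of values is the unit group of \<open>R\<close>. No normalization is imposed.\<close>

definition two_cocycles ::
    "('a, 'm) ring_scheme \<Rightarrow> ('g, 'l) monoid_scheme \<Rightarrow> ('g \<Rightarrow> 'a \<Rightarrow> 'a) \<Rightarrow> ('g \<times> 'g \<Rightarrow> 'a) set"
  where "two_cocycles R G \<eta> =
    {f \<in> carrier G \<times> carrier G \<rightarrow>\<^sub>E Units R.
      \<forall>g \<in> carrier G. \<forall>h \<in> carrier G. \<forall>k \<in> carrier G.
        f (g, h) \<otimes>\<^bsub>R\<^esub> f (g \<otimes>\<^bsub>G\<^esub> h, k) = \<eta> g (f (h, k)) \<otimes>\<^bsub>R\<^esub> f (g, h \<otimes>\<^bsub>G\<^esub> k)}"

text \<open>For a finite group \<open>G\<close>. The element \<open>\<Sum>\<^sub>g \<beta>\<^sub>g u\<^sub>g\<close> is represented by its coefficient family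
  \<open>g \<mapsto> \<beta>\<^sub>g\<close>, so the addition and the left scalar multiplication are pointwise. In the product
  \<open>x y\<close>, the coefficient at \<open>k\<close> collects the terms of the pairs \<open>(g, h)\<close> with \<open>g h = k\<close>, that is
  \<open>h = g\<inverse> k\<close>. As \<open>f\<close> need not be normalized, the unit element is \<open>f(1,1)\<inverse> u\<^sub>1\<close>: the cocycle
  identity gives \<open>f(1,g) = f(1,1)\<close> and \<open>f(g,1) = g(f(1,1))\<close>.\<close>

definition crossed_product ::
    "('a, 'm) ring_scheme \<Rightarrow> ('g, 'l) monoid_scheme \<Rightarrow> ('g \<Rightarrow> 'a \<Rightarrow> 'a) \<Rightarrow> ('g \<times> 'g \<Rightarrow> 'a)
      \<Rightarrow> ('a, 'g \<Rightarrow> 'a) module"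
  where "crossed_product R G \<eta> f =
    \<lparr> carrier = carrier G \<rightarrow>\<^sub>E carrier R,
      monoid.mult = (\<lambda>x y. \<lambda>k \<in> carrier G.
        \<Oplus>\<^bsub>R\<^esub>g \<in> carrier G.
          x g \<otimes>\<^bsub>R\<^esub> \<eta> g (y (inv\<^bsub>G\<^esub> g \<otimes>\<^bsub>G\<^esub> k)) \<otimes>\<^bsub>R\<^esub> f (g, inv\<^bsub>G\<^esub> g \<otimes>\<^bsub>G\<^esub> k)),
      one = (\<lambda>k \<in> carrier G. if k = \<one>\<^bsub>G\<^esub> then inv\<^bsub>R\<^esub> f (\<one>\<^bsub>G\<^esub>, \<one>\<^bsub>G\<^esub>) else \<zero>\<^bsub>R\<^esub>),
      ring.zero = (\<lambda>k \<in> carrier G. \<zero>\<^bsub>R\<^esub>),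
      add = (\<lambda>x y. \<lambda>k \<in> carrier G. x k \<oplus>\<^bsub>R\<^esub> y k),
      smult = (\<lambda>c x. \<lambda>k \<in> carrier G. c \<otimes>\<^bsub>R\<^esub> x k) \<rparr>"

text \<open>The element \<open>\<beta> u\<^sub>g\<close>.\<close>

definition cp_monomial ::
    "('a, 'm) ring_scheme \<Rightarrow> ('g, 'l) monoid_scheme \<Rightarrow> 'a \<Rightarrow> 'g \<Rightarrow> 'g \<Rightarrow> 'a"
  where "cp_monomial R G \<beta> g = (\<lambda>k \<in> carrier G. if k = g then \<beta> else \<zero>\<^bsub>R\<^esub>)"

definition hamming_weight ::
    "('a, 'm) ring_scheme \<Rightarrow> ('g, 'l) monoid_scheme \<Rightarrow> ('g \<Rightarrow> 'a) \<Rightarrow> nat"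
  where "hamming_weight R G x = card {g \<in> carrier G. x g \<noteq> \<zero>\<^bsub>R\<^esub>}"

definition hamming_isometries ::
    "('a, 'm) ring_scheme \<Rightarrow> ('g, 'l) monoid_scheme \<Rightarrow> ('a, 'g \<Rightarrow> 'a) module
      \<Rightarrow> ('a, 'g \<Rightarrow> 'a) module \<Rightarrow> (('g \<Rightarrow> 'a) \<Rightarrow> 'g \<Rightarrow> 'a) set"
  where "hamming_isometries R G A B =
    {\<psi> \<in> ring_iso A B.
      (\<forall>c \<in> carrier R. \<forall>x \<in> carrier A. \<psi> (c \<odot>\<^bsub>A\<^esub> x) = c \<odot>\<^bsub>B\<^esub> \<psi> x) \<and>
      (\<forall>x \<in> carrier A. hamming_weight R G (\<psi> x) = hamming_weight R G x)}"

definition crossed_products ::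
    "('a, 'm) ring_scheme \<Rightarrow> ('g, 'l) monoid_scheme \<Rightarrow> ('g \<Rightarrow> 'a \<Rightarrow> 'a)
      \<Rightarrow> ('a, 'g \<Rightarrow> 'a) module set"
  where "crossed_products R G \<eta> = crossed_product R G \<eta> ` two_cocycles R G \<eta>"

definition isometry_rel ::
    "('a, 'm) ring_scheme \<Rightarrow> ('g, 'l) monoid_scheme \<Rightarrow> ('g \<Rightarrow> 'a \<Rightarrow> 'a)
      \<Rightarrow> ('a, 'g \<Rightarrow> 'a) module rel"
  where "isometry_rel R G \<eta> =
    {(A, B). A \<in> crossed_products R G \<eta> \<and> B \<in> crossed_products R G \<eta> \<and>
      hamming_isometries R G A B \<noteq> {}}"

definition hamming_isometry_classes ::
    "('a, 'm) ring_scheme \<Rightarrow> ('g, 'l) monoid_scheme \<Rightarrow> ('g \<Rightarrow> 'a \<Rightarrow> 'a)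
      \<Rightarrow> ('a, 'g \<Rightarrow> 'a) module set set"
  where "hamming_isometry_classes R G \<eta> = crossed_products R G \<eta> // isometry_rel R G \<eta>"

lemma crossed_product_monomial_mult:
  assumes R: "cring R" and G: "group G" "finite (carrier G)"
    and \<eta>: "\<eta> \<in> hom G (RingAutoGroup R)" and f: "f \<in> two_cocycles R G \<eta>"
    and g: "g \<in> carrier G" and h: "h \<in> carrier G"
    and \<beta>: "\<beta> \<in> carrier R" and \<gamma>: "\<gamma> \<in> carrier R"
  shows "cp_monomial R G \<beta> g \<otimes>\<^bsub>crossed_product R G \<eta> f\<^esub> cp_monomial R G \<gamma> h
    = cp_monomial R G (\<beta> \<otimes>\<^bsub>R\<^esub> \<eta> g \<gamma> \<otimes>\<^bsub>R\<^esub> f (g, h)) (g \<otimes>\<^bsub>G\<^esub> h)"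
proof -
  interpret R: cring R by (rule R)
  interpret G: group G by (rule G)
  have \<eta>_hom: "\<eta> a \<in> ring_hom R R" if "a \<in> carrier G" for a
    using \<eta> that by (auto simp: hom_def RingAutoGroup_def ring_auto_def)
  have \<eta>_closed: "\<eta> a b \<in> carrier R" if "a \<in> carrier G" "b \<in> carrier R" for a b
    using \<eta>_hom[OF that(1)] that(2) by (rule ring_hom_closed)
  have \<eta>_zero: "\<eta> a \<zero>\<^bsub>R\<^esub> = \<zero>\<^bsub>R\<^esub>" if "a \<in> carrier G" for a
    using ring_hom_zero[OF \<eta>_hom[OF that]] R.ring_axioms by blast
  have f_closed: "f (a, b) \<in> carrier R" if "a \<in> carrier G" "b \<in> carrier G" for a b
    using f that by (auto simp: two_cocycles_def PiE_iff)
  have "(\<Oplus>\<^bsub>R\<^esub>a \<in> carrier G. cp_monomial R G \<beta> g a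
        \<otimes>\<^bsub>R\<^esub> \<eta> a (cp_monomial R G \<gamma> h (inv\<^bsub>G\<^esub> a \<otimes>\<^bsub>G\<^esub> k)) \<otimes>\<^bsub>R\<^esub> f (a, inv\<^bsub>G\<^esub> a \<otimes>\<^bsub>G\<^esub> k))
      = cp_monomial R G (\<beta> \<otimes>\<^bsub>R\<^esub> \<eta> g \<gamma> \<otimes>\<^bsub>R\<^esub> f (g, h)) (g \<otimes>\<^bsub>G\<^esub> h) k"
    (is "?S = ?T") if k: "k \<in> carrier G" for k
  proof -
    let ?t = "\<eta> g (cp_monomial R G \<gamma> h (inv\<^bsub>G\<^esub> g \<otimes>\<^bsub>G\<^esub> k)) \<otimes>\<^bsub>R\<^esub> f (g, inv\<^bsub>G\<^esub> g \<otimes>\<^bsub>G\<^esub> k)"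
    have cl: "cp_monomial R G \<gamma> h b \<in> carrier R" if "b \<in> carrier G" for b
      using that \<gamma> by (simp add: cp_monomial_def)
    have "?S = (\<Oplus>\<^bsub>R\<^esub>a \<in> carrier G. if g = a then
        \<beta> \<otimes>\<^bsub>R\<^esub> \<eta> a (cp_monomial R G \<gamma> h (inv\<^bsub>G\<^esub> a \<otimes>\<^bsub>G\<^esub> k)) \<otimes>\<^bsub>R\<^esub> f (a, inv\<^bsub>G\<^esub> a \<otimes>\<^bsub>G\<^esub> k)
        else \<zero>\<^bsub>R\<^esub>)"
      using k \<beta> by (intro R.finsum_cong')
        (auto simp: cp_monomial_def \<eta>_closed \<eta>_zero f_closed \<gamma>)
    also have "\<dots> = \<beta> \<otimes>\<^bsub>R\<^esub> \<eta> g (cp_monomial R G \<gamma> h (inv\<^bsub>G\<^esub> g \<otimes>\<^bsub>G\<^esub> k))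
        \<otimes>\<^bsub>R\<^esub> f (g, inv\<^bsub>G\<^esub> g \<otimes>\<^bsub>G\<^esub> k)"
      using g k \<beta> by (intro R.finsum_singleton) (auto simp: G(2) cl \<eta>_closed f_closed)
    also have "\<dots> = ?T"
    proof (cases "k = g \<otimes>\<^bsub>G\<^esub> h")
      case True
      then have "inv\<^bsub>G\<^esub> g \<otimes>\<^bsub>G\<^esub> k = h"
        using g h by (simp add: G.m_assoc[symmetric])
      then show ?thesis using True k h by (simp add: cp_monomial_def)
    next
      case False
      then have "inv\<^bsub>G\<^esub> g \<otimes>\<^bsub>G\<^esub> k \<noteq> h"
        using g h k by (metis G.inv_solve_left)
      then show ?thesis using False g k \<beta>
        by (simp add: cp_monomial_def \<eta>_zero f_closed)
    qed
    finally show ?thesis .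
  qed
  then show ?thesis
    by (intro ext) (auto simp: crossed_product_def cp_monomial_def)
qed

lemma equiv_isometry_rel:
  assumes R: "cring R" and G: "group G" and \<eta>: "\<eta> \<in> hom G (RingAutoGroup R)"
  shows "equiv (crossed_products R G \<eta>) (isometry_rel R G \<eta>)"
proof (rule equivI)
  interpret R: cring R by (rule R)
  interpret G: group G by (rule G)
  have \<eta>_closed: "\<eta> a b \<in> carrier R" if "a \<in> carrier G" "b \<in> carrier R" for a b
    using \<eta> that by (auto simp: hom_def RingAutoGroup_def ring_auto_def ring_hom_def)
  have closed: "x \<otimes>\<^bsub>A\<^esub> y \<in> carrier A" "x \<oplus>\<^bsub>A\<^esub> y \<in> carrier A" "\<one>\<^bsub>A\<^esub> \<in> carrier A"
      "c \<in> carrier R \<Longrightarrow> c \<odot>\<^bsub>A\<^esub> x \<in> carrier A"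
    if "A \<in> crossed_products R G \<eta>" "x \<in> carrier A" "y \<in> carrier A" for A x y c
    using that unfolding crossed_products_def crossed_product_def two_cocycles_def
    by (auto simp: PiE_iff \<eta>_closed Units_def intro!: R.finsum_closed R.Units_inv_closed)
  have one_closed: "\<one>\<^bsub>A\<^esub> \<in> carrier A" if "A \<in> crossed_products R G \<eta>" for A
  proof -
    have "\<zero>\<^bsub>A\<^esub> \<in> carrier A"
      using that by (auto simp: crossed_products_def crossed_product_def)
    then show ?thesis using closed(3) that by blast
  qed
  show "isometry_rel R G \<eta> \<subseteq> crossed_products R G \<eta> \<times> crossed_products R G \<eta>"
    by (auto simp: isometry_rel_def)
  show "refl_on (crossed_products R G \<eta>) (isometry_rel R G \<eta>)"
  proof (rule refl_onI)
    fix A assume "A \<in> crossed_products R G \<eta>"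
    moreover have "id \<in> hamming_isometries R G A A"
      by (simp add: hamming_isometries_def ring_iso_set_refl)
    ultimately show "(A, A) \<in> isometry_rel R G \<eta>"
      by (auto simp: isometry_rel_def)
  qed
  show "trans (isometry_rel R G \<eta>)"
  proof (rule transI)
    fix A B C assume AB: "(A, B) \<in> isometry_rel R G \<eta>" and BC: "(B, C) \<in> isometry_rel R G \<eta>"
    then obtain \<psi> \<theta> where \<psi>: "\<psi> \<in> hamming_isometries R G A B"
      and \<theta>: "\<theta> \<in> hamming_isometries R G B C"
      by (auto simp: isometry_rel_def)
    have cl: "\<psi> x \<in> carrier B" if "x \<in> carrier A" for x
      using \<psi> that by (auto simp: hamming_isometries_def ring_iso_def ring_hom_def)
    have "\<theta> \<circ> \<psi> \<in> ring_iso A C"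
      using \<psi> \<theta> by (auto simp: hamming_isometries_def intro: ring_iso_set_trans)
    then have "\<theta> \<circ> \<psi> \<in> hamming_isometries R G A C"
      using \<psi> \<theta> cl by (simp add: hamming_isometries_def)
    then show "(A, C) \<in> isometry_rel R G \<eta>"
      using AB BC by (auto simp: isometry_rel_def)
  qed
  show "sym (isometry_rel R G \<eta>)"
  proof (rule symI)
    fix A B assume AB: "(A, B) \<in> isometry_rel R G \<eta>"
    then obtain \<psi> where \<psi>: "\<psi> \<in> hamming_isometries R G A B"
      and A: "A \<in> crossed_products R G \<eta>" and B: "B \<in> crossed_products R G \<eta>"
      by (auto simp: isometry_rel_def)
    have bij: "bij_betw \<psi> (carrier A) (carrier B)" and hom: "\<psi> \<in> ring_hom A B"
      using \<psi> by (auto simp: hamming_isometries_def ring_iso_def)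
    define \<theta> where "\<theta> = inv_into (carrier A) \<psi>"
    have bij': "bij_betw \<theta> (carrier B) (carrier A)"
      unfolding \<theta>_def by (rule bij_betw_inv_into[OF bij])
    have cl: "\<theta> y \<in> carrier A" if "y \<in> carrier B" for y
      using bij' that by (auto simp: bij_betw_def)
    have right: "\<psi> (\<theta> y) = y" if "y \<in> carrier B" for y
      unfolding \<theta>_def using bij that by (rule bij_betw_inv_into_right)
    have left: "\<theta> y = x" if "x \<in> carrier A" "\<psi> x = y" for x y
      unfolding \<theta>_def using bij that by (auto intro: bij_betw_inv_into_left)
    have "\<theta> \<in> ring_hom B A"
    proof (rule ring_hom_memI)
      show "\<theta> (x \<otimes>\<^bsub>B\<^esub> y) = \<theta> x \<otimes>\<^bsub>A\<^esub> \<theta> y" "\<theta> (x \<oplus>\<^bsub>B\<^esub> y) = \<theta> x \<oplus>\<^bsub>A\<^esub> \<theta> y"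
        if "x \<in> carrier B" "y \<in> carrier B" for x y
        using that A hom
        by (auto intro!: left closed simp: cl right ring_hom_mult ring_hom_add)
      show "\<theta> \<one>\<^bsub>B\<^esub> = \<one>\<^bsub>A\<^esub>"
        using one_closed[OF A] hom by (intro left) (auto simp: ring_hom_one)
    qed (rule cl)
    moreover have "\<theta> (c \<odot>\<^bsub>B\<^esub> y) = c \<odot>\<^bsub>A\<^esub> \<theta> y" if "c \<in> carrier R" "y \<in> carrier B" for c y
      using that A \<psi> cl
      by (intro left closed) (auto simp: right hamming_isometries_def)
    moreover have "hamming_weight R G (\<theta> y) = hamming_weight R G y" if "y \<in> carrier B" for y
      using \<psi> cl[OF that] right[OF that] by (auto simp: hamming_isometries_def)
    ultimately have "\<theta> \<in> hamming_isometries R G B A"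
      using bij' by (simp add: hamming_isometries_def ring_iso_def)
    then show "(B, A) \<in> isometry_rel R G \<eta>"
      using A B by (auto simp: isometry_rel_def)
  qed
qed

text \<open>In the intended use \<open>k\<close> divides \<open>r\<close> and \<open>r\<close> divides \<open>n k\<close>, so both divisions are exact.\<close>

definition modulus_m :: "nat \<Rightarrow> nat \<Rightarrow> nat \<Rightarrow> nat \<Rightarrow> nat"
  where "modulus_m q n r k = gcd (q ^ k - 1) (n * k div r)"

definition A_set :: "nat \<Rightarrow> nat \<Rightarrow> nat \<Rightarrow> nat \<Rightarrow> nat set"
  where "A_set q n r k = {1..modulus_m q n r k}"

definition sim_rel :: "nat \<Rightarrow> nat \<Rightarrow> nat \<Rightarrow> nat \<Rightarrow> nat rel"
  where "sim_rel q n r k =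
    {(a, b). a \<in> A_set q n r k \<and> b \<in> A_set q n r k \<and>
      (\<exists>j::int. coprime j (int n) \<and> [j = 1] (mod int (r div k)) \<and>
        [int a * j = int b] (mod int (modulus_m q n r k)))}"

end

theory Submission
  imports Defs
begin

text \<open>
  An isometry maps each \<open>u\<^sub>g\<close> to some \<open>\<gamma>\<^sub>g u\<^bsub>\<pi> g\<^esub>\<close>, where \<open>\<pi>\<close> is an automorphism of the group
  with \<open>\<eta> \<circ> \<pi> = \<eta>\<close>; so \<open>f\<close> and \<open>f'\<close> give isometric crossed products iff \<open>f\<close> is cohomologous to
  some \<open>\<pi>\<^sup>* f'\<close>. For the cyclic group generated by \<open>\<sigma>\<close>, of order \<open>n\<close>, the class of \<open>f\<close> is determined
  by the product of the \<open>f (\<sigma>\<^sup>i, \<sigma>)\<close>, \<open>i < n\<close>, which lies in the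
  fixed field and matters modulo norms (this is the periodicity of the cohomology of cyclic groups),
  and \<open>\<pi>\<^sup>*\<close> raises it to the power \<open>j\<close> when \<open>\<pi> \<sigma> = \<sigma>\<^sup>j\<close>.
  The multiplicative group of the field being cyclic, everything is computed on discrete logarithms:
  cocycles become integer valued modulo \<open>T = q\<^sup>r - 1\<close>, with \<open>\<sigma>\<close> acting as multiplication by
  \<open>P = q\<^sup>k\<close>; the units of the fixed field become \<open>M \<int>\<close> with \<open>M = T / (P - 1)\<close>, and the norms are \<open>t M \<int>\<close>
  with \<open>t = n k / r\<close>.
\<close>

subsection \<open>Integer-valued cocycles\<close>

definition twisted_cocycle :: "int \<Rightarrow> int \<Rightarrow> (nat \<Rightarrow> nat \<Rightarrow> int) \<Rightarrow> bool"
  where "twisted_cocycle T p L \<longleftrightarrow>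
    (\<forall>i j l. [L i j + L (i + j) l = p ^ i * L j l + L i (j + l)] (mod T))"

lemma twisted_cocycle_expand:
  assumes "twisted_cocycle T p L"
  shows "[L i j = p ^ i * L 0 0 + (\<Sum>l<j. L (i + l) 1 - p ^ i * L l 1)] (mod T)"
proof (induction j)
  case 0
  have "[L i 0 + L (i + 0) 0 = p ^ i * L 0 0 + L i (0 + 0)] (mod T)"
    using assms unfolding twisted_cocycle_def by blast
  then show ?case by (simp add: cong_iff_dvd_diff algebra_simps)
next
  case (Suc j)
  have "[L i j + L (i + j) 1 = p ^ i * L j 1 + L i (j + 1)] (mod T)"
    using assms unfolding twisted_cocycle_def by blast
  then have "T dvd L i j + L (i + j) 1 - (p ^ i * L j 1 + L i (Suc j))"
    by (simp add: cong_iff_dvd_diff)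
  moreover have "T dvd L i j - (p ^ i * L 0 0 + (\<Sum>l<j. L (i + l) 1 - p ^ i * L l 1))"
    using Suc.IH by (simp add: cong_iff_dvd_diff)
  ultimately have "T dvd (L i j - (p ^ i * L 0 0 + (\<Sum>l<j. L (i + l) 1 - p ^ i * L l 1)))
      - (L i j + L (i + j) 1 - (p ^ i * L j 1 + L i (Suc j)))"
    by (rule dvd_diff[rotated])
  then show ?case by (simp add: cong_iff_dvd_diff algebra_simps)
qed

lemma sum_periodic_shift:
  fixes h :: "nat \<Rightarrow> int"
  assumes "\<And>i. h (i + n) = h i"
  shows "(\<Sum>l<n. h (i + l)) = (\<Sum>l<n. h l)"
proof (induction i)
  case (Suc i)
  have "(\<Sum>l<n. h (Suc i + l)) + h i = (\<Sum>l<Suc n. h (i + l))"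
    by (subst sum.lessThan_Suc_shift) simp
  also have "\<dots> = (\<Sum>l<n. h (i + l)) + h i"
    using assms by simp
  finally show ?case using Suc by simp
qed simp

lemma sum_periodic_mult:
  fixes h :: "nat \<Rightarrow> int"
  assumes "\<And>i. h (i + n) = h i"
  shows "(\<Sum>l<j * n. h l) = int j * (\<Sum>l<n. h l)"
proof (induction j)
  case (Suc j)
  have "(\<Sum>l<Suc j * n. h l) = (\<Sum>l<j * n. h l) + (\<Sum>l<n. h (j * n + l))"
    using sum.nat_group[of h n "Suc j"] sum.nat_group[of h n j]
    by (simp add: sum.shift_bounds_nat_ivl[of h 0 "j * n" n, simplified] lessThan_atLeast0 add.commute)
  moreover have "(\<Sum>l<n. h (j * n + l)) = (\<Sum>l<n. h l)"
    using assms by (rule sum_periodic_shift)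
  ultimately show ?case using Suc by (simp add: distrib_right)
qed simp

lemma twisted_cocycle_invariant_fixed:
  assumes L: "twisted_cocycle T p L"
    and per: "\<And>i j. L (i + n) j = L i j" "\<And>i j. L i (j + n) = L i j"
  shows "[p * (\<Sum>i<n. L i 1) = (\<Sum>i<n. L i 1)] (mod T)"
proof -
  have "[L 1 i + L (1 + i) 1 = p * L i 1 + L 1 (1 + i)] (mod T)" for i
    using L unfolding twisted_cocycle_def by (metis power_one_right add.commute)
  then have "[(\<Sum>i<n. L 1 i + L (1 + i) 1) = (\<Sum>i<n. p * L i 1 + L 1 (1 + i))] (mod T)"
    by (intro cong_sum)
  moreover have "(\<Sum>i<n. L (1 + i) 1) = (\<Sum>i<n. L i 1)" "(\<Sum>i<n. L 1 (1 + i)) = (\<Sum>i<n. L 1 i)"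
    using sum_periodic_shift[of "\<lambda>i. L i 1" n 1] sum_periodic_shift[of "L 1" n 1] per by auto
  ultimately show ?thesis
    by (simp add: sum.distrib sum_distrib_left[symmetric] cong_add_lcancel add.commute)
      (simp only: cong_sym_eq)
qed

lemma twisted_cocycle_trivial:
  assumes d: "twisted_cocycle T p d"
    and per: "\<And>i j. d (i + n) j = d i j" "\<And>i j. d i (j + n) = d i j"
    and z: "[(\<Sum>i<n. d i 1) = (\<Sum>i<n. p ^ i) * z] (mod T)"
  obtains c :: "nat \<Rightarrow> int" where "\<And>i. [c (i + n) = c i] (mod T)"
    "\<And>i j. [d i j = c i + p ^ i * c j - c (i + j)] (mod T)"
proof
  define c where "c = (\<lambda>i. d 0 0 + (\<Sum>l<i. p ^ l * z - d l 1))"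
  have c_add: "c (i + j) = c i + (\<Sum>l<j. p ^ (i + l) * z - d (i + l) 1)" for i j
    by (induction j) (auto simp: c_def)
  show "[d i j = c i + p ^ i * c j - c (i + j)] (mod T)" for i j
  proof -
    have "c i + p ^ i * c j - c (i + j) = p ^ i * d 0 0 + (\<Sum>l<j. d (i + l) 1 - p ^ i * d l 1)"
      unfolding c_add by (simp add: c_def sum_subtractf power_add sum_distrib_left
        right_diff_distrib distrib_left mult.assoc)
    then show ?thesis using twisted_cocycle_expand[OF d] by simp
  qed
  show "[c (i + n) = c i] (mod T)" for i
  proof -
    let ?I = "\<Sum>i<n. d i 1"
    have fixd: "[p ^ i * ?I = ?I] (mod T)"
    proof (induction i)
      case (Suc i)
      have "[p * (p ^ i * ?I) = p * ?I] (mod T)"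
        using Suc by (rule cong_scalar_left)
      then show ?case
        using twisted_cocycle_invariant_fixed[OF d per] by (auto simp: mult.assoc intro: cong_trans)
    qed simp
    have "c (i + n) - c i = p ^ i * ((\<Sum>i<n. p ^ i) * z) - ?I"
      using sum_periodic_shift[of "\<lambda>l. d l 1" n i] per
      by (simp add: c_add sum_subtractf power_add sum_distrib_left sum_distrib_right mult.assoc)
    moreover have "[p ^ i * ((\<Sum>i<n. p ^ i) * z) = ?I] (mod T)"
      using z fixd cong_scalar_left[of _ _ T "p ^ i"] by (meson cong_sym cong_trans)
    ultimately show ?thesis by (simp add: cong_iff_dvd_diff)
  qed
qed

lemma twisted_cocycle_pullback_invariant:
  assumes L: "twisted_cocycle T p L" and per: "\<And>i j. L (i + n) j = L i j"
    and j: "[p ^ j = p] (mod T)"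
  obtains z where
    "[(\<Sum>i<n. L (i * j) j) = (\<Sum>i<n. p ^ i) * z + int j * (\<Sum>i<n. L i 1)] (mod T)"
proof
  let ?z = "L 0 0 - (\<Sum>l<j. L l 1)"
  have "[L (i * j) j = p ^ i * ?z + (\<Sum>l<j. L (i * j + l) 1)] (mod T)" for i
  proof -
    have "[L (i * j) j = p ^ (i * j) * ?z + (\<Sum>l<j. L (i * j + l) 1)] (mod T)"
      using twisted_cocycle_expand[OF L, of "i * j" j]
      by (simp add: sum_subtractf sum_distrib_left algebra_simps)
    moreover have "[p ^ (i * j) = p ^ i] (mod T)"
      using cong_pow[OF j, of i] by (simp add: power_mult[symmetric] mult.commute)
    ultimately show ?thesis
      by (meson cong_add cong_refl cong_scalar_right cong_trans)
  qed
  then have "[(\<Sum>i<n. L (i * j) j) = (\<Sum>i<n. p ^ i * ?z + (\<Sum>l<j. L (i * j + l) 1))] (mod T)"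
    by (intro cong_sum)
  moreover have "(\<Sum>i<n. \<Sum>l<j. L (i * j + l) 1) = (\<Sum>l<n * j. L l 1)"
    using sum.nat_group[of "\<lambda>l. L l 1" j n]
    by (simp add: sum.shift_bounds_nat_ivl[of _ 0 _ j, simplified] lessThan_atLeast0 add.commute)
  moreover have "(\<Sum>l<n * j. L l 1) = int j * (\<Sum>i<n. L i 1)"
    using sum_periodic_mult[of "\<lambda>l. L l 1" n j] per by (simp add: mult.commute)
  ultimately show
    "[(\<Sum>i<n. L (i * j) j) = (\<Sum>i<n. p ^ i) * ?z + int j * (\<Sum>i<n. L i 1)] (mod T)"
    by (simp add: sum.distrib sum_distrib_right)
qed

lemma power_cong_one_iff:
  fixes p :: int
  assumes "p \<ge> 2" "s > 0"
  shows "[p ^ a = p ^ b] (mod (p ^ s - 1)) \<longleftrightarrow> [a = b] (mod s)"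
proof -
  have red: "[p ^ a = p ^ (a mod s)] (mod (p ^ s - 1))" for a
  proof -
    have "[p ^ s = 1] (mod (p ^ s - 1))"
      by (simp add: cong_iff_dvd_diff)
    then have "[(p ^ s) ^ (a div s) * p ^ (a mod s) = 1 ^ (a div s) * p ^ (a mod s)] (mod (p ^ s - 1))"
      by (intro cong_mult cong_pow cong_refl)
    then show ?thesis by (simp add: power_mult[symmetric] power_add[symmetric])
  qed
  have bound: "1 \<le> p ^ (a mod s)" "p ^ (a mod s) \<le> p ^ (s - 1)" for a
    using assms by (auto intro!: power_increasing simp: less_Suc_eq_le[symmetric])
  have "p ^ (s - 1) < p ^ s"
    using assms by (intro power_strict_increasing) auto
  then have "\<bar>p ^ (a mod s) - p ^ (b mod s)\<bar> < p ^ s - 1"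
    using bound[of a] bound[of b] by linarith
  then have "[p ^ (a mod s) = p ^ (b mod s)] (mod (p ^ s - 1)) \<longleftrightarrow> p ^ (a mod s) = p ^ (b mod s)"
    using dvd_imp_le_int[of "p ^ (a mod s) - p ^ (b mod s)" "p ^ s - 1"]
    by (auto simp: cong_iff_dvd_diff)
  also have "\<dots> \<longleftrightarrow> [a = b] (mod s)"
    using assms by (simp add: cong_def power_inject_exp)
  finally show ?thesis
    using red by (meson cong_sym cong_trans)
qed

lemma quotient_bij_betw:
  assumes A: "equiv A E" and B: "equiv B S"
    and into: "\<And>x. x \<in> A \<Longrightarrow> h x \<in> B"
    and iff: "\<And>x y. x \<in> A \<Longrightarrow> y \<in> A \<Longrightarrow> (x, y) \<in> E \<longleftrightarrow> (h x, h y) \<in> S"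
    and onto: "\<And>y. y \<in> B \<Longrightarrow> \<exists>x\<in>A. (h x, y) \<in> S"
  shows "\<exists>\<Phi>. bij_betw \<Phi> (A // E) (B // S)"
proof
  define \<Phi> where "\<Phi> c = S `` (h ` c)" for c
  have \<Phi>: "\<Phi> (E `` {x}) = S `` {h x}" if x: "x \<in> A" for x
  proof
    show "S `` {h x} \<subseteq> \<Phi> (E `` {x})"
      unfolding \<Phi>_def using equiv_class_self[OF A x] by blast
    show "\<Phi> (E `` {x}) \<subseteq> S `` {h x}"
    proof
      fix y assume "y \<in> \<Phi> (E `` {x})"
      then obtain x' where x': "(x, x') \<in> E" "(h x', y) \<in> S"
        unfolding \<Phi>_def by blast
      then have "x' \<in> A" using equivE[OF A] by blast
      then have "(h x, h x') \<in> S" using x x' iff by blast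
      then show "y \<in> S `` {h x}"
        using x' equivE[OF B] by (meson ImageI singletonI transD)
    qed
  qed
  show "bij_betw \<Phi> (A // E) (B // S)"
    unfolding bij_betw_def
  proof
    show "inj_on \<Phi> (A // E)"
    proof (rule inj_onI, elim quotientE)
      fix c d x y assume *: "\<Phi> c = \<Phi> d" "x \<in> A" "c = E `` {x}" "y \<in> A" "d = E `` {y}"
      then have "S `` {h x} = S `` {h y}" using \<Phi> by simp
      then have "(h x, h y) \<in> S" using into * by (intro eq_equiv_class[OF _ B]) auto
      then show "c = d" using * iff by (simp add: equiv_class_eq[OF A])
    qed
    show "\<Phi> ` (A // E) = B // S"
    proof
      show "\<Phi> ` (A // E) \<subseteq> B // S"
        using \<Phi> into by (auto elim!: quotientE intro!: quotientI)
      show "B // S \<subseteq> \<Phi> ` (A // E)"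
      proof
        fix c assume "c \<in> B // S"
        then obtain y where y: "y \<in> B" "c = S `` {y}" by (rule quotientE)
        obtain x where x: "x \<in> A" "(h x, y) \<in> S" using onto[OF y(1)] by blast
        have "c = \<Phi> (E `` {x})"
          using y x by (simp add: \<Phi> equiv_class_eq[OF B])
        then show "c \<in> \<Phi> ` (A // E)" using x(1) by (blast intro: quotientI)
      qed
    qed
  qed
qed

subsection \<open>Isometries of crossed products\<close>

lemma ring_auto_homD:
  assumes "\<eta> \<in> hom G (RingAutoGroup R)" "g \<in> carrier G"
  shows "\<eta> g \<in> ring_hom R R" "\<eta> g \<in> Bij (carrier R)"
  using assms by (auto simp: hom_def RingAutoGroup_def ring_auto_def)

lemma ring_auto_hom_mult:
  assumes "\<eta> \<in> hom G (RingAutoGroup R)" "g \<in> carrier G" "h \<in> carrier G" "c \<in> carrier R"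
  shows "\<eta> (g \<otimes>\<^bsub>G\<^esub> h) c = \<eta> g (\<eta> h c)"
proof -
  have "\<eta> (g \<otimes>\<^bsub>G\<^esub> h) = \<eta> g \<otimes>\<^bsub>RingAutoGroup R\<^esub> \<eta> h"
    using assms by (intro hom_mult)
  then show ?thesis
    using assms ring_auto_homD(2)[OF assms(1)]
    by (simp add: RingAutoGroup_def BijGroup_def compose_def)
qed

lemma ring_auto_hom_one:
  assumes "group G" "\<eta> \<in> hom G (RingAutoGroup R)" "c \<in> carrier R"
  shows "\<eta> \<one>\<^bsub>G\<^esub> c = c"
proof -
  interpret group G by fact
  have "\<eta> \<one>\<^bsub>G\<^esub> \<in> Bij (carrier R)"
    using ring_auto_homD(2)[OF assms(2) one_closed] .
  then have "inj_on (\<eta> \<one>\<^bsub>G\<^esub>) (carrier R)" "\<eta> \<one>\<^bsub>G\<^esub> c \<in> carrier R"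
    using assms(3) by (auto simp: Bij_def bij_betw_def)
  then show ?thesis
    using ring_auto_hom_mult[OF assms(2) one_closed one_closed assms(3)] assms(3)
    by (simp add: inj_on_eq_iff)
qed

lemma cp_monomial_closed:
  assumes "ring R" "c \<in> carrier R"
  shows "cp_monomial R G c g \<in> carrier (crossed_product R G \<eta> f)"
proof -
  interpret ring R by fact
  show ?thesis using assms by (simp add: cp_monomial_def crossed_product_def)
qed

lemma smult_cp_monomial:
  assumes "ring R" "c \<in> carrier R" "b \<in> carrier R"
  shows "c \<odot>\<^bsub>crossed_product R G \<eta> f\<^esub> cp_monomial R G b g = cp_monomial R G (c \<otimes>\<^bsub>R\<^esub> b) g"
proof -
  interpret ring R by fact
  show ?thesis using assms by (auto simp: cp_monomial_def crossed_product_def)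
qed

lemma cp_monomial_eqD:
  assumes "cp_monomial R G c g = cp_monomial R G c' g'" "g \<in> carrier G" "c \<noteq> \<zero>\<^bsub>R\<^esub>"
  shows "g = g' \<and> c = c'"
  using fun_cong[OF assms(1), of g] assms(2,3) by (auto simp: cp_monomial_def split: if_splits)

lemma hamming_weight_cp_monomial:
  assumes "g \<in> carrier G" "c \<noteq> \<zero>\<^bsub>R\<^esub>"
  shows "hamming_weight R G (cp_monomial R G c g) = 1"
proof -
  have "{h \<in> carrier G. cp_monomial R G c g h \<noteq> \<zero>\<^bsub>R\<^esub>} = {g}"
    using assms by (auto simp: cp_monomial_def)
  then show ?thesis by (simp add: hamming_weight_def)
qed

lemma hamming_weight_oneE:
  assumes "x \<in> carrier (crossed_product R G \<eta> f)" "hamming_weight R G x = 1"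
  obtains c g where "g \<in> carrier G" "c \<in> carrier R" "c \<noteq> \<zero>\<^bsub>R\<^esub>" "x = cp_monomial R G c g"
proof -
  obtain g where g: "{h \<in> carrier G. x h \<noteq> \<zero>\<^bsub>R\<^esub>} = {g}"
    using assms(2) unfolding hamming_weight_def by (rule card_1_singletonE)
  have ext: "x \<in> carrier G \<rightarrow>\<^sub>E carrier R"
    using assms(1) by (simp add: crossed_product_def)
  show thesis
  proof
    show "g \<in> carrier G" "x g \<noteq> \<zero>\<^bsub>R\<^esub>" using g by auto
    then show "x g \<in> carrier R" using ext by auto
    show "x = cp_monomial R G (x g) g"
    proof
      fix h
      show "x h = cp_monomial R G (x g) g h"
        using g ext by (cases "h \<in> carrier G") (auto simp: cp_monomial_def)
    qed
  qed
qed

lemma two_cocyclesD: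
  assumes "f \<in> two_cocycles R G \<eta>"
  shows "\<And>g h. g \<in> carrier G \<Longrightarrow> h \<in> carrier G \<Longrightarrow> f (g, h) \<in> Units R"
    "\<And>g h k. g \<in> carrier G \<Longrightarrow> h \<in> carrier G \<Longrightarrow> k \<in> carrier G \<Longrightarrow>
      f (g, h) \<otimes>\<^bsub>R\<^esub> f (g \<otimes>\<^bsub>G\<^esub> h, k) = \<eta> g (f (h, k)) \<otimes>\<^bsub>R\<^esub> f (g, h \<otimes>\<^bsub>G\<^esub> k)"
  using assms by (auto simp: two_cocycles_def PiE_iff)

lemma hamming_isometry_imp_data:
  assumes F: "field F" and G: "group G" "finite (carrier G)"
    and \<eta>: "\<eta> \<in> hom G (RingAutoGroup F)"
    and f: "f \<in> two_cocycles F G \<eta>" and f': "f' \<in> two_cocycles F G \<eta>"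
    and \<psi>: "\<psi> \<in> hamming_isometries F G (crossed_product F G \<eta> f) (crossed_product F G \<eta> f')"
  obtains \<pi> \<gamma> where "\<pi> \<in> hom G G" "inj_on \<pi> (carrier G)"
    "\<And>g. g \<in> carrier G \<Longrightarrow> \<gamma> g \<in> Units F"
    "\<And>g. g \<in> carrier G \<Longrightarrow> \<eta> (\<pi> g) = \<eta> g"
    "\<And>g h. g \<in> carrier G \<Longrightarrow> h \<in> carrier G \<Longrightarrow>
      f (g, h) \<otimes>\<^bsub>F\<^esub> \<gamma> (g \<otimes>\<^bsub>G\<^esub> h) = \<gamma> g \<otimes>\<^bsub>F\<^esub> \<eta> g (\<gamma> h) \<otimes>\<^bsub>F\<^esub> f' (\<pi> g, \<pi> h)"
proof -
  interpret F: field F by (rule F)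
  interpret G: group G by (rule G)
  let ?A = "crossed_product F G \<eta> f" and ?B = "crossed_product F G \<eta> f'"
  let ?u = "cp_monomial F G"
  have hom: "\<psi> \<in> ring_hom ?A ?B" and bij: "bij_betw \<psi> (carrier ?A) (carrier ?B)"
    and lin: "\<And>c x. c \<in> carrier F \<Longrightarrow> x \<in> carrier ?A \<Longrightarrow> \<psi> (c \<odot>\<^bsub>?A\<^esub> x) = c \<odot>\<^bsub>?B\<^esub> \<psi> x"
    and wt: "\<And>x. x \<in> carrier ?A \<Longrightarrow> hamming_weight F G (\<psi> x) = hamming_weight F G x"
    using \<psi> by (auto simp: hamming_isometries_def ring_iso_def)
  have cl: "?u c g \<in> carrier ?A" if "c \<in> carrier F" for c g
    using that by (intro cp_monomial_closed F.ring_axioms)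
  have "\<exists>c h. h \<in> carrier G \<and> c \<in> carrier F \<and> c \<noteq> \<zero>\<^bsub>F\<^esub> \<and> \<psi> (?u \<one>\<^bsub>F\<^esub> g) = ?u c h"
    if g: "g \<in> carrier G" for g
  proof -
    have "hamming_weight F G (\<psi> (?u \<one>\<^bsub>F\<^esub> g)) = 1"
      using g wt[OF cl[OF F.one_closed]] by (simp add: hamming_weight_cp_monomial)
    moreover have "\<psi> (?u \<one>\<^bsub>F\<^esub> g) \<in> carrier ?B"
      using cl bij by (auto simp: bij_betw_def)
    ultimately show ?thesis by (meson hamming_weight_oneE)
  qed
  then obtain \<gamma> \<pi> where \<pi>: "\<And>g. g \<in> carrier G \<Longrightarrow> \<pi> g \<in> carrier G"
    and \<gamma>: "\<And>g. g \<in> carrier G \<Longrightarrow> \<gamma> g \<in> carrier F" "\<And>g. g \<in> carrier G \<Longrightarrow> \<gamma> g \<noteq> \<zero>\<^bsub>F\<^esub>"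
    and \<psi>u: "\<And>g. g \<in> carrier G \<Longrightarrow> \<psi> (?u \<one>\<^bsub>F\<^esub> g) = ?u (\<gamma> g) (\<pi> g)"
    by metis
  have \<psi>mon: "\<psi> (?u c g) = ?u (c \<otimes>\<^bsub>F\<^esub> \<gamma> g) (\<pi> g)" if "c \<in> carrier F" "g \<in> carrier G" for c g
    using lin[OF that(1) cl[OF F.one_closed, of g]] that \<gamma>
    by (simp add: smult_cp_monomial[OF F.ring_axioms] \<psi>u)
  have fU: "f (g, h) \<in> Units F" "f' (g, h) \<in> Units F" if "g \<in> carrier G" "h \<in> carrier G" for g h
    using two_cocyclesD(1)[OF f that] two_cocyclesD(1)[OF f' that] .
  then have fcl: "f (g, h) \<in> carrier F" "f' (g, h) \<in> carrier F" "f (g, h) \<noteq> \<zero>\<^bsub>F\<^esub>" "f' (g, h) \<noteq> \<zero>\<^bsub>F\<^esub>"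
    if "g \<in> carrier G" "h \<in> carrier G" for g h
    using that by (auto simp: F.field_Units)
  have \<eta>h: "\<eta> g \<in> ring_hom F F" if "g \<in> carrier G" for g
    using ring_auto_homD(1)[OF \<eta> that] .
  have \<eta>cl: "\<eta> g c \<in> carrier F" if "g \<in> carrier G" "c \<in> carrier F" for g c
    using ring_hom_closed[OF \<eta>h] that by blast
  have \<eta>1: "\<eta> g \<one>\<^bsub>F\<^esub> = \<one>\<^bsub>F\<^esub>" if "g \<in> carrier G" for g
    using ring_hom_one[OF \<eta>h] that by blast
  have \<eta>m: "\<eta> g (b \<otimes>\<^bsub>F\<^esub> c) = \<eta> g b \<otimes>\<^bsub>F\<^esub> \<eta> g c" if "g \<in> carrier G" "b \<in> carrier F" "c \<in> carrier F" for g b c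
    using ring_hom_mult[OF \<eta>h] that by blast
  have \<eta>0: "\<eta> g c \<noteq> \<zero>\<^bsub>F\<^esub>" if "g \<in> carrier G" "c \<in> carrier F" "c \<noteq> \<zero>\<^bsub>F\<^esub>" for g c
    using \<eta>m[of g c "inv\<^bsub>F\<^esub> c"] \<eta>1[of g] that \<eta>cl
    by (metis F.Units_inv_closed F.Units_r_inv F.field_Units DiffI F.l_null F.one_not_zero singletonD)
  have key: "(\<eta> g c \<otimes>\<^bsub>F\<^esub> f (g, h)) \<otimes>\<^bsub>F\<^esub> \<gamma> (g \<otimes>\<^bsub>G\<^esub> h) = \<gamma> g \<otimes>\<^bsub>F\<^esub> \<eta> (\<pi> g) (c \<otimes>\<^bsub>F\<^esub> \<gamma> h) \<otimes>\<^bsub>F\<^esub> f' (\<pi> g, \<pi> h)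
      \<and> \<pi> (g \<otimes>\<^bsub>G\<^esub> h) = \<pi> g \<otimes>\<^bsub>G\<^esub> \<pi> h"
    if g: "g \<in> carrier G" and h: "h \<in> carrier G" and c: "c \<in> carrier F" "c \<noteq> \<zero>\<^bsub>F\<^esub>" for g h c
  proof -
    have "?u (\<eta> g c \<otimes>\<^bsub>F\<^esub> f (g, h) \<otimes>\<^bsub>F\<^esub> \<gamma> (g \<otimes>\<^bsub>G\<^esub> h)) (\<pi> (g \<otimes>\<^bsub>G\<^esub> h))
        = \<psi> (?u (\<eta> g c \<otimes>\<^bsub>F\<^esub> f (g, h)) (g \<otimes>\<^bsub>G\<^esub> h))"
      using g h c by (simp add: \<psi>mon \<eta>cl fcl)
    also have "\<dots> = \<psi> (?u \<one>\<^bsub>F\<^esub> g \<otimes>\<^bsub>?A\<^esub> ?u c h)"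
      using g h c by (simp add: crossed_product_monomial_mult[OF F.is_cring G \<eta> f] \<eta>cl fcl)
    also have "\<dots> = \<psi> (?u \<one>\<^bsub>F\<^esub> g) \<otimes>\<^bsub>?B\<^esub> \<psi> (?u c h)"
      using c by (intro ring_hom_mult[OF hom] cl) auto
    also have "\<dots> = ?u (\<gamma> g \<otimes>\<^bsub>F\<^esub> \<eta> (\<pi> g) (c \<otimes>\<^bsub>F\<^esub> \<gamma> h) \<otimes>\<^bsub>F\<^esub> f' (\<pi> g, \<pi> h)) (\<pi> g \<otimes>\<^bsub>G\<^esub> \<pi> h)"
      using g h c \<pi>[OF g] \<pi>[OF h] \<gamma>(1)[OF g] \<gamma>(1)[OF h]
      by (simp add: \<psi>mon crossed_product_monomial_mult[OF F.is_cring G \<eta> f'])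
    finally show ?thesis
      using cp_monomial_eqD[of F G _ "\<pi> (g \<otimes>\<^bsub>G\<^esub> h)"] g h c \<pi> \<gamma>
      by (simp add: F.integral_iff \<eta>cl fcl \<eta>0)
  qed
  show thesis
  proof
    show \<pi>hom: "\<pi> \<in> hom G G"
      using key[of _ _ "\<one>\<^bsub>F\<^esub>"] \<pi> by (auto simp: hom_def)
    have \<pi>1: "\<pi> \<one>\<^bsub>G\<^esub> = \<one>\<^bsub>G\<^esub>"
      using hom_one[OF \<pi>hom] G.is_group by blast
    show "inj_on \<pi> (carrier G)"
    proof (rule inj_onI)
      fix g h assume gh: "g \<in> carrier G" "h \<in> carrier G" "\<pi> g = \<pi> h"
      have "\<psi> (?u (\<gamma> h) g) = \<psi> (?u (\<gamma> g) h)"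
        using gh \<gamma> by (simp add: \<psi>mon F.m_comm)
      then have "?u (\<gamma> h) g = ?u (\<gamma> g) h"
        using bij gh \<gamma> cl by (auto simp: bij_betw_def inj_on_def)
      then show "g = h" using cp_monomial_eqD gh \<gamma> by metis
    qed
    show "\<gamma> g \<in> Units F" if "g \<in> carrier G" for g
      using \<gamma>[OF that] by (simp add: F.field_Units)
    show \<eta>\<pi>: "\<eta> (\<pi> g) = \<eta> g" if g: "g \<in> carrier G" for g
    proof -
      have "\<eta> (\<pi> g) c = \<eta> g c" if c: "c \<in> carrier F" for c
      proof (cases "c = \<zero>\<^bsub>F\<^esub>")
        case True
        then show ?thesis
          using ring_hom_zero[OF \<eta>h[OF g] F.ring_axioms F.ring_axioms]
            ring_hom_zero[OF \<eta>h[OF \<pi>[OF g]] F.ring_axioms F.ring_axioms] by simp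
      next
        case False
        let ?w = "\<gamma> g \<otimes>\<^bsub>F\<^esub> \<eta> (\<pi> g) (\<gamma> \<one>\<^bsub>G\<^esub>) \<otimes>\<^bsub>F\<^esub> f' (\<pi> g, \<pi> \<one>\<^bsub>G\<^esub>)"
        note cls = g c \<pi> \<gamma> \<eta>cl fcl \<pi>1
        have w: "?w \<in> carrier F" "?w \<noteq> \<zero>\<^bsub>F\<^esub>"
          using cls by (auto simp: F.integral_iff \<eta>0)
        have w1: "f (g, \<one>\<^bsub>G\<^esub>) \<otimes>\<^bsub>F\<^esub> \<gamma> g = ?w"
          using key[OF g G.one_closed F.one_closed] cls by (simp add: \<eta>1)
        have "\<eta> g c \<otimes>\<^bsub>F\<^esub> (f (g, \<one>\<^bsub>G\<^esub>) \<otimes>\<^bsub>F\<^esub> \<gamma> g) = \<gamma> g \<otimes>\<^bsub>F\<^esub> (\<eta> (\<pi> g) c \<otimes>\<^bsub>F\<^esub> \<eta> (\<pi> g) (\<gamma> \<one>\<^bsub>G\<^esub>)) \<otimes>\<^bsub>F\<^esub> f' (\<pi> g, \<pi> \<one>\<^bsub>G\<^esub>)"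
          using key[OF g G.one_closed c False] cls by (simp add: \<eta>m F.m_assoc)
        also have "\<dots> = \<eta> (\<pi> g) c \<otimes>\<^bsub>F\<^esub> ?w"
          using cls by (simp add: F.m_assoc F.m_lcomm)
        finally have "\<eta> g c \<otimes>\<^bsub>F\<^esub> ?w = \<eta> (\<pi> g) c \<otimes>\<^bsub>F\<^esub> ?w"
          by (simp only: w1)
        then show ?thesis using w cls F.m_rcancel by (metis)
      qed
      moreover have "\<eta> g \<in> extensional (carrier F)" "\<eta> (\<pi> g) \<in> extensional (carrier F)"
        using ring_auto_homD(2)[OF \<eta>] g \<pi> by (auto simp: Bij_def)
      ultimately show ?thesis by (metis extensionalityI)
    qed
    show "f (g, h) \<otimes>\<^bsub>F\<^esub> \<gamma> (g \<otimes>\<^bsub>G\<^esub> h) = \<gamma> g \<otimes>\<^bsub>F\<^esub> \<eta> g (\<gamma> h) \<otimes>\<^bsub>F\<^esub> f' (\<pi> g, \<pi> h)"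
      if "g \<in> carrier G" "h \<in> carrier G" for g h
      using key[OF that F.one_closed] that \<gamma> fcl by (simp add: \<eta>1 \<eta>\<pi>)
  qed
qed

lemma hamming_isometry_of_data:
  fixes F :: "('a, 'm) ring_scheme" and G :: "('g, 'l) monoid_scheme"
  assumes F: "field F" and G: "group G" "finite (carrier G)"
    and \<eta>: "\<eta> \<in> hom G (RingAutoGroup F)"
    and f: "f \<in> two_cocycles F G \<eta>" and f': "f' \<in> two_cocycles F G \<eta>"
    and \<pi>: "\<pi> \<in> hom G G" "inj_on \<pi> (carrier G)"
    and \<gamma>: "\<And>g. g \<in> carrier G \<Longrightarrow> \<gamma> g \<in> Units F"
    and \<eta>\<pi>: "\<And>g. g \<in> carrier G \<Longrightarrow> \<eta> (\<pi> g) = \<eta> g"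
    and eq: "\<And>g h. g \<in> carrier G \<Longrightarrow> h \<in> carrier G \<Longrightarrow>
      f (g, h) \<otimes>\<^bsub>F\<^esub> \<gamma> (g \<otimes>\<^bsub>G\<^esub> h) = \<gamma> g \<otimes>\<^bsub>F\<^esub> \<eta> g (\<gamma> h) \<otimes>\<^bsub>F\<^esub> f' (\<pi> g, \<pi> h)"
  shows "hamming_isometries F G (crossed_product F G \<eta> f) (crossed_product F G \<eta> f') \<noteq> {}"
proof -
  interpret F: field F by (rule F)
  interpret G: group G by (rule G)
  let ?A = "crossed_product F G \<eta> f" and ?B = "crossed_product F G \<eta> f'"
  have \<pi>cl: "\<pi> g \<in> carrier G" if "g \<in> carrier G" for g
    using \<pi>(1) that by (auto simp: hom_def)
  have \<pi>m: "\<pi> (g \<otimes>\<^bsub>G\<^esub> h) = \<pi> g \<otimes>\<^bsub>G\<^esub> \<pi> h" if "g \<in> carrier G" "h \<in> carrier G" for g h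
    using hom_mult[OF \<pi>(1) that] .
  interpret \<pi>: group_hom G G \<pi>
    using \<pi>(1) by (intro group_hom.intro group_hom_axioms.intro G.is_group)
  have \<pi>im: "\<pi> ` carrier G = carrier G"
    using G(2) \<pi>(2) \<pi>cl by (intro card_subset_eq) (auto simp: card_image)
  then have \<pi>bij: "bij_betw \<pi> (carrier G) (carrier G)"
    using \<pi>(2) by (simp add: bij_betw_def)
  define \<rho> where "\<rho> = inv_into (carrier G) \<pi>"
  have \<rho>\<pi>: "\<rho> (\<pi> g) = g" if "g \<in> carrier G" for g
    unfolding \<rho>_def using \<pi>bij that by (rule bij_betw_inv_into_left)
  have \<pi>\<rho>: "\<pi> (\<rho> g) = g" if "g \<in> carrier G" for g
    unfolding \<rho>_def using \<pi>bij that by (rule bij_betw_inv_into_right)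
  have \<rho>cl: "\<rho> g \<in> carrier G" if "g \<in> carrier G" for g
    using that \<pi>im by (auto simp: \<rho>_def intro: inv_into_into)
  have \<gamma>c: "\<gamma> g \<in> carrier F" "\<gamma> g \<noteq> \<zero>\<^bsub>F\<^esub>" if "g \<in> carrier G" for g
    using \<gamma>[OF that] by (auto simp: F.field_Units)
  have fcl: "f (g, h) \<in> carrier F" "f' (g, h) \<in> carrier F" if "g \<in> carrier G" "h \<in> carrier G" for g h
    using two_cocyclesD(1)[OF f that] two_cocyclesD(1)[OF f' that] by auto
  have \<eta>h: "\<eta> g \<in> ring_hom F F" if "g \<in> carrier G" for g
    using ring_auto_homD(1)[OF \<eta> that] .
  have \<eta>cl: "\<eta> g c \<in> carrier F" if "g \<in> carrier G" "c \<in> carrier F" for g c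
    using ring_hom_closed[OF \<eta>h] that by blast
  have \<eta>m: "\<eta> g (b \<otimes>\<^bsub>F\<^esub> c) = \<eta> g b \<otimes>\<^bsub>F\<^esub> \<eta> g c" if "g \<in> carrier G" "b \<in> carrier F" "c \<in> carrier F" for g b c
    using ring_hom_mult[OF \<eta>h] that by blast
  define \<psi> where "\<psi> = (\<lambda>x. \<lambda>g\<in>carrier G. \<gamma> (\<rho> g) \<otimes>\<^bsub>F\<^esub> x (\<rho> g))"
  define \<theta> where "\<theta> = (\<lambda>y. \<lambda>g\<in>carrier G. inv\<^bsub>F\<^esub> \<gamma> g \<otimes>\<^bsub>F\<^esub> y (\<pi> g))"
  have cA: "carrier ?A = carrier G \<rightarrow>\<^sub>E carrier F" and cB: "carrier ?B = carrier G \<rightarrow>\<^sub>E carrier F"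
    by (simp_all add: crossed_product_def)
  have \<psi>\<pi>: "\<psi> x (\<pi> g) = \<gamma> g \<otimes>\<^bsub>F\<^esub> x g" if "g \<in> carrier G" for x g
    using that by (simp add: \<psi>_def \<pi>cl \<rho>\<pi>)
  have \<psi>ext: "\<psi> x \<in> extensional (carrier G)" for x
    by (simp add: \<psi>_def)
  have \<psi>cl: "\<psi> x \<in> carrier ?B" if "x \<in> carrier ?A" for x
    using that by (auto simp: \<psi>_def cA cB \<rho>cl \<gamma>c PiE_iff)
  have eqI: "y = z" if "y \<in> extensional (carrier G)" "z \<in> extensional (carrier G)"
    "\<And>g. g \<in> carrier G \<Longrightarrow> y (\<pi> g) = z (\<pi> g)" for y z :: "'g \<Rightarrow> 'a"
  proof (rule extensionalityI[OF that(1,2)])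
    show "y g = z g" if "g \<in> carrier G" for g
      using \<open>\<And>g. g \<in> carrier G \<Longrightarrow> y (\<pi> g) = z (\<pi> g)\<close>[OF \<rho>cl[OF that]] by (simp add: \<pi>\<rho> that)
  qed
  have bij: "bij_betw \<psi> (carrier ?A) (carrier ?B)"
  proof (rule bij_betwI[where g = \<theta>])
    show "\<psi> \<in> carrier ?A \<rightarrow> carrier ?B" using \<psi>cl by blast
    show "\<theta> \<in> carrier ?B \<rightarrow> carrier ?A"
      using \<gamma> by (auto simp: \<theta>_def cA cB PiE_iff \<pi>cl)
    show "\<theta> (\<psi> x) = x" if "x \<in> carrier ?A" for x
      using that \<gamma> \<gamma>c
      by (intro extensionalityI[of _ "carrier G"])
        (auto simp: \<theta>_def \<psi>\<pi> cA PiE_iff F.m_assoc[symmetric])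
    show "\<psi> (\<theta> y) = y" if "y \<in> carrier ?B" for y
      using that \<gamma> \<gamma>c \<pi>cl
      by (intro eqI) (auto simp: \<psi>ext \<psi>\<pi> \<theta>_def cB PiE_iff F.m_assoc[symmetric])
  qed
  have "\<psi> \<in> ring_hom ?A ?B"
  proof (rule ring_hom_memI)
    show "\<psi> x \<in> carrier ?B" if "x \<in> carrier ?A" for x using \<psi>cl that .
    fix x y assume x: "x \<in> carrier ?A" and y: "y \<in> carrier ?A"
    have xc: "x g \<in> carrier F" "y g \<in> carrier F" if "g \<in> carrier G" for g
      using x y that by (auto simp: cA)
    show "\<psi> (x \<oplus>\<^bsub>?A\<^esub> y) = \<psi> x \<oplus>\<^bsub>?B\<^esub> \<psi> y"
      by (intro eqI) (auto simp: \<psi>ext \<psi>\<pi> crossed_product_def \<pi>cl F.r_distr \<gamma>c xc)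
    show "\<psi> (x \<otimes>\<^bsub>?A\<^esub> y) = \<psi> x \<otimes>\<^bsub>?B\<^esub> \<psi> y"
    proof (rule eqI)
      fix k assume k: "k \<in> carrier G"
      define t where "t = (\<lambda>g. x g \<otimes>\<^bsub>F\<^esub> \<eta> g (y (inv\<^bsub>G\<^esub> g \<otimes>\<^bsub>G\<^esub> k)) \<otimes>\<^bsub>F\<^esub> f (g, inv\<^bsub>G\<^esub> g \<otimes>\<^bsub>G\<^esub> k))"
      define t' where "t' = (\<lambda>a. \<psi> x a \<otimes>\<^bsub>F\<^esub> \<eta> a (\<psi> y (inv\<^bsub>G\<^esub> a \<otimes>\<^bsub>G\<^esub> \<pi> k)) \<otimes>\<^bsub>F\<^esub> f' (a, inv\<^bsub>G\<^esub> a \<otimes>\<^bsub>G\<^esub> \<pi> k))"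
      have tcl: "t g \<in> carrier F" if "g \<in> carrier G" for g
        using that k xc \<eta>cl fcl by (simp add: t_def)
      have t': "t' (\<pi> g) = \<gamma> k \<otimes>\<^bsub>F\<^esub> t g" if g: "g \<in> carrier G" for g
      proof -
        let ?h = "inv\<^bsub>G\<^esub> g \<otimes>\<^bsub>G\<^esub> k"
        have h: "?h \<in> carrier G" using g k by simp
        have gh: "g \<otimes>\<^bsub>G\<^esub> ?h = k" using g k by (simp add: G.m_assoc[symmetric])
        have \<pi>h: "inv\<^bsub>G\<^esub> (\<pi> g) \<otimes>\<^bsub>G\<^esub> \<pi> k = \<pi> ?h"
          using g k by (simp add: \<pi>m)
        have "t' (\<pi> g) = (\<gamma> g \<otimes>\<^bsub>F\<^esub> x g) \<otimes>\<^bsub>F\<^esub> \<eta> g (\<gamma> ?h \<otimes>\<^bsub>F\<^esub> y ?h) \<otimes>\<^bsub>F\<^esub> f' (\<pi> g, \<pi> ?h)"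
          unfolding t'_def \<pi>h using g h by (simp add: \<psi>\<pi> \<eta>\<pi>)
        also have "\<dots> = (x g \<otimes>\<^bsub>F\<^esub> \<eta> g (y ?h)) \<otimes>\<^bsub>F\<^esub> (\<gamma> g \<otimes>\<^bsub>F\<^esub> \<eta> g (\<gamma> ?h) \<otimes>\<^bsub>F\<^esub> f' (\<pi> g, \<pi> ?h))"
          using g h xc \<gamma>c fcl \<eta>cl \<pi>cl by (simp add: \<eta>m F.m_ac)
        also have "\<dots> = (x g \<otimes>\<^bsub>F\<^esub> \<eta> g (y ?h)) \<otimes>\<^bsub>F\<^esub> (f (g, ?h) \<otimes>\<^bsub>F\<^esub> \<gamma> k)"
          using eq[OF g h] gh by simp
        also have "\<dots> = \<gamma> k \<otimes>\<^bsub>F\<^esub> t g"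
          using g h k xc \<gamma>c fcl \<eta>cl by (simp add: t_def F.m_ac)
        finally show ?thesis .
      qed
      have "\<psi> (x \<otimes>\<^bsub>?A\<^esub> y) (\<pi> k) = \<gamma> k \<otimes>\<^bsub>F\<^esub> (\<Oplus>\<^bsub>F\<^esub>g\<in>carrier G. t g)"
        using k by (simp add: \<psi>\<pi> crossed_product_def t_def)
      also have "\<dots> = (\<Oplus>\<^bsub>F\<^esub>g\<in>carrier G. \<gamma> k \<otimes>\<^bsub>F\<^esub> t g)"
        using k \<gamma>c tcl G(2) by (intro F.finsum_rdistr) auto
      also have "\<dots> = (\<Oplus>\<^bsub>F\<^esub>g\<in>carrier G. t' (\<pi> g))"
        using k \<gamma>c tcl by (intro F.finsum_cong') (auto simp: t')
      also have "\<dots> = (\<Oplus>\<^bsub>F\<^esub>a\<in>\<pi> ` carrier G. t' a)"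
        using k \<gamma>c tcl by (intro F.finsum_reindex[symmetric] \<pi>(2)) (auto simp: t')
      also have "\<dots> = (\<psi> x \<otimes>\<^bsub>?B\<^esub> \<psi> y) (\<pi> k)"
        using k \<pi>cl by (simp add: \<pi>im crossed_product_def t'_def)
      finally show "\<psi> (x \<otimes>\<^bsub>?A\<^esub> y) (\<pi> k) = (\<psi> x \<otimes>\<^bsub>?B\<^esub> \<psi> y) (\<pi> k)" .
    qed (auto simp: \<psi>ext crossed_product_def)
  next
    have "\<gamma> \<one>\<^bsub>G\<^esub> \<otimes>\<^bsub>F\<^esub> inv\<^bsub>F\<^esub> f (\<one>\<^bsub>G\<^esub>, \<one>\<^bsub>G\<^esub>) = inv\<^bsub>F\<^esub> f' (\<one>\<^bsub>G\<^esub>, \<one>\<^bsub>G\<^esub>)"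
    proof -
      let ?e = "\<one>\<^bsub>G\<^esub>" and ?c = "f (\<one>\<^bsub>G\<^esub>, \<one>\<^bsub>G\<^esub>)" and ?c' = "f' (\<one>\<^bsub>G\<^esub>, \<one>\<^bsub>G\<^esub>)"
      have U: "?c \<in> Units F" "?c' \<in> Units F" "\<gamma> ?e \<in> Units F"
        using two_cocyclesD(1)[OF f] two_cocyclesD(1)[OF f'] \<gamma> by auto
      then have cl: "?c \<in> carrier F" "?c' \<in> carrier F" "\<gamma> ?e \<in> carrier F"
          "inv\<^bsub>F\<^esub> ?c \<in> carrier F" "inv\<^bsub>F\<^esub> ?c' \<in> carrier F"
        by auto
      have "\<gamma> ?e \<otimes>\<^bsub>F\<^esub> ?c = \<gamma> ?e \<otimes>\<^bsub>F\<^esub> (\<gamma> ?e \<otimes>\<^bsub>F\<^esub> ?c')"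
        using eq[OF G.one_closed G.one_closed] cl ring_auto_hom_one[OF G(1) \<eta>]
        by (simp add: F.m_ac)
      then have c: "?c = \<gamma> ?e \<otimes>\<^bsub>F\<^esub> ?c'"
        using U cl by (simp add: F.Units_l_cancel)
      have "\<gamma> ?e \<otimes>\<^bsub>F\<^esub> inv\<^bsub>F\<^esub> ?c = (\<gamma> ?e \<otimes>\<^bsub>F\<^esub> inv\<^bsub>F\<^esub> ?c) \<otimes>\<^bsub>F\<^esub> (?c' \<otimes>\<^bsub>F\<^esub> inv\<^bsub>F\<^esub> ?c')"
        using U cl by simp
      also have "\<dots> = (\<gamma> ?e \<otimes>\<^bsub>F\<^esub> ?c') \<otimes>\<^bsub>F\<^esub> inv\<^bsub>F\<^esub> ?c \<otimes>\<^bsub>F\<^esub> inv\<^bsub>F\<^esub> ?c'"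
        by (simp only: cl F.m_closed F.m_ac)
      finally have "\<gamma> ?e \<otimes>\<^bsub>F\<^esub> inv\<^bsub>F\<^esub> ?c = (\<gamma> ?e \<otimes>\<^bsub>F\<^esub> ?c') \<otimes>\<^bsub>F\<^esub> inv\<^bsub>F\<^esub> ?c \<otimes>\<^bsub>F\<^esub> inv\<^bsub>F\<^esub> ?c'" .
      then show ?thesis
        unfolding c[symmetric] using U cl by simp
    qed
    moreover have "\<pi> g = \<one>\<^bsub>G\<^esub> \<longleftrightarrow> g = \<one>\<^bsub>G\<^esub>" if "g \<in> carrier G" for g
      using inj_on_eq_iff[OF \<pi>(2) that G.one_closed] by simp
    ultimately show "\<psi> \<one>\<^bsub>?A\<^esub> = \<one>\<^bsub>?B\<^esub>"
      by (intro eqI) (simp_all add: \<psi>ext \<psi>\<pi> crossed_product_def \<pi>cl \<gamma>c)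
  qed
  moreover have "\<psi> (c \<odot>\<^bsub>?A\<^esub> x) = c \<odot>\<^bsub>?B\<^esub> \<psi> x" if "c \<in> carrier F" "x \<in> carrier ?A" for c x
    using that by (intro eqI) (auto simp: \<psi>ext \<psi>\<pi> crossed_product_def \<pi>cl \<gamma>c F.m_lcomm PiE_iff)
  moreover have "hamming_weight F G (\<psi> x) = hamming_weight F G x" if "x \<in> carrier ?A" for x
  proof -
    have "{a \<in> carrier G. \<psi> x a \<noteq> \<zero>\<^bsub>F\<^esub>} = \<pi> ` {g \<in> carrier G. x g \<noteq> \<zero>\<^bsub>F\<^esub>}"
    proof (intro equalityI subsetI)
      fix a assume a: "a \<in> {a \<in> carrier G. \<psi> x a \<noteq> \<zero>\<^bsub>F\<^esub>}"
      then have "a = \<pi> (\<rho> a)" "\<rho> a \<in> carrier G" "x (\<rho> a) \<noteq> \<zero>\<^bsub>F\<^esub>"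
        using \<gamma>c(1)[OF \<rho>cl[of a]] by (auto simp: \<pi>\<rho> \<rho>cl \<psi>_def)
      then show "a \<in> \<pi> ` {g \<in> carrier G. x g \<noteq> \<zero>\<^bsub>F\<^esub>}" by blast
    next
      fix a assume "a \<in> \<pi> ` {g \<in> carrier G. x g \<noteq> \<zero>\<^bsub>F\<^esub>}"
      then obtain g where g: "g \<in> carrier G" "x g \<noteq> \<zero>\<^bsub>F\<^esub>" "a = \<pi> g" by blast
      moreover have "x g \<in> carrier F" using that g by (auto simp: cA)
      ultimately show "a \<in> {a \<in> carrier G. \<psi> x a \<noteq> \<zero>\<^bsub>F\<^esub>}"
        using \<gamma>c[OF g(1)] by (simp add: \<psi>\<pi> \<pi>cl F.integral_iff)
    qed
    then show ?thesis
      using \<pi>(2) by (simp add: hamming_weight_def card_image inj_on_def)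
  qed
  ultimately have "\<psi> \<in> hamming_isometries F G ?A ?B"
    using bij by (simp add: hamming_isometries_def ring_iso_def)
  then show ?thesis by blast
qed

subsection \<open>Cyclic groups acting on finite fields\<close>

locale cyclic_action =
  fixes q n r k :: nat
    and F :: "('a, 'm) ring_scheme"
    and C :: "('g, 'l) monoid_scheme"
    and \<sigma> :: 'g
    and \<eta> :: "'g \<Rightarrow> 'a \<Rightarrow> 'a"
  assumes q_prime: "Factorial_Ring.prime q"
    and n_pos: "n > 0" and r_pos: "r > 0" and k_pos: "k > 0"
    and k_dvd: "k dvd r" and rk_dvd: "r div k dvd n"
    and field_F: "field F" and order_F: "order F = q ^ r"
    and group_C: "group C" and \<sigma>_closed: "\<sigma> \<in> carrier C"
    and generate_\<sigma>: "generate C {\<sigma>} = carrier C" and order_C: "order C = n"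
    and \<eta>_hom: "\<eta> \<in> hom C (RingAutoGroup F)"
    and \<eta>_\<sigma>: "\<eta> \<sigma> = frobenius_map F q [^]\<^bsub>RingAutoGroup F\<^esub> k"
begin

sublocale F: field F by (rule field_F)
sublocale C: group C by (rule group_C)

definition "P = int (q ^ k)"
definition "s = r div k"
definition "t = n * k div r"
definition "T = int (q ^ r) - 1"
definition "M = (\<Sum>i<s. P ^ i)"

lemma q_ge_2: "q \<ge> 2"
  using q_prime by (rule prime_ge_2_nat)

lemma P_ge_2: "P \<ge> 2"
proof -
  have "q ^ 1 \<le> q ^ k"
    using q_ge_2 k_pos by (intro power_increasing) auto
  then have "2 \<le> q ^ k" using q_ge_2 by simp
  then show ?thesis unfolding P_def by (metis of_nat_le_iff of_nat_numeral)
qed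

lemma s_pos: "s > 0" and t_pos: "t > 0" and n_eq: "n = t * s"
proof -
  have r: "r = s * k" using k_dvd by (simp add: s_def)
  show s: "s > 0" using r r_pos by (cases "s = 0") auto
  obtain w where w: "n = s * w" using rk_dvd unfolding s_def by blast
  have "n * k = r * w" using r w by (metis mult.assoc mult.commute)
  then have "t = w" using r_pos by (simp add: t_def)
  then show "n = t * s" "t > 0" using w n_pos by (auto simp: mult.commute)
qed

lemma T_eq_power: "T = P ^ s - 1"
  using k_dvd by (simp add: s_def T_def P_def power_mult[symmetric])

lemma T_eq: "T = M * (P - 1)"
  unfolding T_eq_power M_def by (metis power_diff_1_eq mult.commute)

lemma M_pos: "M > 0"
  unfolding M_def
proof (rule sum_pos)
  show "{..<s} \<noteq> {}" using s_pos by (metis lessThan_iff empty_iff)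
  show "0 < P ^ i" for i using P_ge_2 by (intro zero_less_power) linarith
qed simp

lemma norm_exponent: "[(\<Sum>i<n. P ^ i) = int t * M] (mod T)"
proof -
  have h: "P ^ (i + s) mod T = P ^ i mod T" for i
  proof -
    have "[i + s = i] (mod s)" by (simp add: cong_def)
    then have "[P ^ (i + s) = P ^ i] (mod T)"
      unfolding T_eq_power power_cong_one_iff[OF P_ge_2 s_pos] .
    then show ?thesis unfolding cong_def .
  qed
  have *: "(\<Sum>i<n. P ^ i mod T) = int t * (\<Sum>i<s. P ^ i mod T)"
    using sum_periodic_mult[of "\<lambda>i. P ^ i mod T" s t, OF h] by (simp add: n_eq[symmetric])
  have **: "[(\<Sum>i<l. P ^ i) = (\<Sum>i<l. P ^ i mod T)] (mod T)" for l
    by (rule cong_sum, unfold cong_def, rule mod_mod_trivial[symmetric])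
  have "[int t * (\<Sum>i<s. P ^ i mod T) = int t * M] (mod T)"
    unfolding M_def by (rule cong_scalar_left[OF cong_sym[OF **]])
  with **[of n] show ?thesis
    unfolding * by (rule cong_trans)
qed

lemma finite_F: "finite (carrier F)"
  using order_F q_ge_2 unfolding order_def by (intro card_ge_0_finite) auto

lemma finite_C: "finite (carrier C)"
  using order_C n_pos unfolding order_def by (intro card_ge_0_finite) auto

abbreviation "FX \<equiv> Multiplicative_Group.mult_of F"

definition "gen = (SOME a. a \<in> carrier FX \<and> carrier FX = {a [^]\<^bsub>F\<^esub> i | i::nat. i \<in> UNIV})"
definition "E z = gen [^]\<^bsub>FX\<^esub> (z::int)"

lemma gen: "gen \<in> carrier FX" "carrier FX = {gen [^]\<^bsub>F\<^esub> i | i::nat. i \<in> UNIV}"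
  using someI_ex[OF F.finite_field_mult_group_has_gen[OF finite_F, unfolded Bex_def]]
  unfolding gen_def by blast+

sublocale FM: group FX
  by (rule F.field_mult_group)

lemma carrier_FM: "carrier FX = Units F"
  by (simp add: F.field_Units)

lemma E_Units [simp]: "E z \<in> Units F"
  using FM.int_pow_closed[OF gen(1)] by (simp add: E_def F.field_Units)

lemma E_closed [simp]: "E z \<in> carrier F"
  using E_Units by blast

lemma E_surj: "x \<in> Units F \<Longrightarrow> \<exists>z. E z = x"
  using gen(2) unfolding E_def carrier_FM
  by (auto simp: Multiplicative_Group.nat_pow_mult_of[symmetric] int_pow_int[symmetric])

lemma E_add: "E (a + b) = E a \<otimes>\<^bsub>F\<^esub> E b"
  using FM.int_pow_mult[OF gen(1)] by (simp add: E_def)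

lemma ord_gen: "int (FM.ord gen) = T"
proof -
  have "FM.ord gen = order FX"
    using FM.generate_pow_card[OF gen(1)] gen
      FM.generate_pow_on_finite_carrier[OF _ gen(1)] finite_F
    by (simp add: Multiplicative_Group.nat_pow_mult_of order_def)
  also have "\<dots> = q ^ r - 1"
    using F.order_mult_of[OF finite_F] order_F by simp
  finally show ?thesis using q_ge_2 by (simp add: of_nat_diff T_def)
qed

lemma E_eq_iff: "E a = E b \<longleftrightarrow> [a = b] (mod T)"
  unfolding E_def FM.int_pow_eq[OF gen(1)] ord_gen
  by (metis cong_iff_dvd_diff cong_sym)

lemma E_power: "E z [^]\<^bsub>F\<^esub> (l::nat) = E (int l * z)"
proof -
  have "E z [^]\<^bsub>F\<^esub> l = E z [^]\<^bsub>FX\<^esub> (int l)"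
    by (simp add: Multiplicative_Group.nat_pow_mult_of int_pow_int)
  then show ?thesis
    using FM.int_pow_pow[OF gen(1)] by (simp add: E_def mult.commute)
qed

lemma carrier_F_cases:
  assumes "x \<in> carrier F"
  obtains "x = \<zero>\<^bsub>F\<^esub>" | z where "x = E z"
  using assms E_surj by (auto simp: F.field_Units)

definition "dlog x = (SOME z. E z = x)"

lemma E_dlog: "x \<in> Units F \<Longrightarrow> E (dlog x) = x"
  unfolding dlog_def using E_surj by (rule someI_ex)

lemma frobenius_Bij: "frobenius_map F q \<in> Bij (carrier F)"
proof -
  have pow_q: "(x [^]\<^bsub>F\<^esub> q) [^]\<^bsub>F\<^esub> (q ^ (r - 1)) = x" if x: "x \<in> carrier F" for x
  proof -
    have "(x [^]\<^bsub>F\<^esub> q) [^]\<^bsub>F\<^esub> (q ^ (r - 1)) = x [^]\<^bsub>F\<^esub> (q ^ r)"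
      using x r_pos by (simp add: F.nat_pow_pow power_eq_if)
    also have "\<dots> = x"
      using x
    proof (cases rule: carrier_F_cases)
      case 1
      then show ?thesis using q_ge_2 by (simp add: F.nat_pow_zero)
    next
      case (2 z)
      have "[int (q ^ r) * z = z] (mod T)"
        unfolding cong_iff_dvd_diff T_def by (auto simp: dvd_def algebra_simps)
      then show ?thesis using 2 by (simp only: E_power E_eq_iff)
    qed
    finally show ?thesis .
  qed
  have inj: "inj_on (\<lambda>x. x [^]\<^bsub>F\<^esub> q) (carrier F)"
    using pow_q by (rule inj_on_inverseI)
  then have "(\<lambda>x. x [^]\<^bsub>F\<^esub> q) ` carrier F = carrier F"
    using finite_F by (intro endo_inj_surj) auto
  with inj show ?thesis
    by (simp add: Bij_def frobenius_map_def bij_betw_def inj_on_restrict_eq)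
qed

lemma frobenius_power:
  "frobenius_map F q [^]\<^bsub>RingAutoGroup F\<^esub> (i::nat) \<in> Bij (carrier F) \<and>
    (\<forall>x\<in>carrier F. (frobenius_map F q [^]\<^bsub>RingAutoGroup F\<^esub> i) x = x [^]\<^bsub>F\<^esub> (q ^ i))"
proof (induction i)
  case 0
  then show ?case
    using id_Bij[of "carrier F"] by (auto simp: RingAutoGroup_def BijGroup_def restrict_def)
next
  case (Suc i)
  let ?\<phi> = "frobenius_map F q"
  have eq: "?\<phi> [^]\<^bsub>RingAutoGroup F\<^esub> Suc i = compose (carrier F) (?\<phi> [^]\<^bsub>RingAutoGroup F\<^esub> i) ?\<phi>"
    using Suc frobenius_Bij by (simp add: RingAutoGroup_def BijGroup_def)
  have "compose (carrier F) (?\<phi> [^]\<^bsub>RingAutoGroup F\<^esub> i) ?\<phi> \<in> Bij (carrier F)"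
    using Suc frobenius_Bij by (intro compose_Bij) auto
  moreover have "compose (carrier F) (?\<phi> [^]\<^bsub>RingAutoGroup F\<^esub> i) ?\<phi> x = x [^]\<^bsub>F\<^esub> (q ^ Suc i)"
    if "x \<in> carrier F" for x
  proof -
    have "?\<phi> x = x [^]\<^bsub>F\<^esub> q" using that by (simp add: frobenius_map_def)
    then show ?thesis
      using Suc that by (simp add: compose_def F.nat_pow_pow)
  qed
  ultimately show ?case unfolding eq by blast
qed

abbreviation "u \<equiv> \<lambda>i::nat. \<sigma> [^]\<^bsub>C\<^esub> i"

lemma u_closed [simp]: "u i \<in> carrier C"
  using \<sigma>_closed by simp

lemma u_add: "u i \<otimes>\<^bsub>C\<^esub> u j = u (i + j)"
  using \<sigma>_closed by (rule C.nat_pow_mult)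

lemma carrier_C: "carrier C = range u"
  using C.generate_pow_on_finite_carrier[OF finite_C \<sigma>_closed] generate_\<sigma> by auto

lemma ord_\<sigma>: "C.ord \<sigma> = n"
  using C.generate_pow_card[OF \<sigma>_closed] generate_\<sigma> order_C by (simp add: order_def)

lemma u_eq_iff: "u i = u j \<longleftrightarrow> [i = j] (mod n)"
proof -
  have "u i = u j \<longleftrightarrow> [int j = int i] (mod int n)"
    using C.int_pow_eq[OF \<sigma>_closed, of "int i" "int j"]
    by (simp add: int_pow_int ord_\<sigma> cong_iff_dvd_diff)
  then show ?thesis using cong_int_iff cong_sym_eq by metis
qed

lemma u_add_n [simp]: "u (i + n) = u i"
  unfolding u_eq_iff by (simp add: cong_def)

lemma \<eta>_u: "\<eta> (u i) (E z) = E (P ^ i * z)"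
proof (induction i arbitrary: z)
  case 0
  then show ?case using ring_auto_hom_one[OF group_C \<eta>_hom] by simp
next
  case (Suc i)
  have "\<eta> (u (Suc i)) (E z) = \<eta> (u i) (\<eta> \<sigma> (E z))"
    using ring_auto_hom_mult[OF \<eta>_hom u_closed \<sigma>_closed] by simp
  also have "\<eta> \<sigma> (E z) = E (P * z)"
    using frobenius_power[of k] by (simp add: \<eta>_\<sigma> E_power P_def)
  finally show ?case using Suc by (simp add: mult_ac)
qed

lemma \<eta>_eqI:
  assumes "[P ^ i = P ^ j] (mod T)"
  shows "\<eta> (u i) = \<eta> (u j)"
proof (rule extensionalityI)
  show "\<eta> (u i) \<in> extensional (carrier F)" "\<eta> (u j) \<in> extensional (carrier F)"
    using ring_auto_homD(2)[OF \<eta>_hom u_closed] by (auto simp: Bij_def)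
  fix x assume "x \<in> carrier F"
  then show "\<eta> (u i) x = \<eta> (u j) x"
  proof (cases rule: carrier_F_cases)
    case 1
    have "\<eta> (u l) \<zero>\<^bsub>F\<^esub> = \<zero>\<^bsub>F\<^esub>" for l
      using ring_hom_zero[OF ring_auto_homD(1)[OF \<eta>_hom u_closed] F.ring_axioms F.ring_axioms] .
    then show ?thesis using 1 by simp
  next
    case (2 z)
    show ?thesis
      unfolding 2 \<eta>_u E_eq_iff using assms by (rule cong_scalar_right)
  qed
qed

definition "idx g = (SOME i. u i = g)"

lemma u_idx:
  assumes "g \<in> carrier C"
  shows "u (idx g) = g"
proof -
  have "\<exists>i. u i = g" using assms unfolding carrier_C by blast
  then show ?thesis unfolding idx_def by (rule someI_ex)
qed

lemma idx_u: "[idx (u i) = i] (mod n)"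
  using u_idx[OF u_closed] by (simp only: u_eq_iff)

abbreviation "Z2 \<equiv> two_cocycles F C \<eta>"
definition "L f i j = dlog (f (u i, u j))"
definition "I f = (\<Sum>i<n. L f i 1)"

lemma E_L: "f \<in> Z2 \<Longrightarrow> E (L f i j) = f (u i, u j)"
  unfolding L_def by (rule E_dlog[OF two_cocyclesD(1)[OF _ u_closed u_closed]])

lemma L_periodic: "L f (i + n) j = L f i j" "L f i (j + n) = L f i j"
  by (simp_all only: L_def u_add_n)

lemma L_cocycle:
  assumes "f \<in> Z2"
  shows "twisted_cocycle T P (L f)"
  unfolding twisted_cocycle_def
proof (intro allI)
  fix i j l
  have "E (L f i j + L f (i + j) l) = E (P ^ i * L f j l + L f i (j + l))"
    using two_cocyclesD(2)[OF assms u_closed u_closed u_closed, of i j l] E_L[OF assms]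
    by (simp only: E_add \<eta>_u[symmetric] u_add)
  then show "[L f i j + L f (i + j) l = P ^ i * L f j l + L f i (j + l)] (mod T)"
    by (simp only: E_eq_iff)
qed

lemma coprime_of_inj:
  fixes j :: nat
  assumes "\<And>i. [i * j = 0] (mod n) \<Longrightarrow> [i = 0] (mod n)"
  shows "coprime j n"
proof -
  define d where "d = gcd j n"
  obtain a b where a: "j = d * a" and b: "n = d * b"
    unfolding d_def by (meson dvdE gcd_dvd1 gcd_dvd2)
  have "b * j = n * a" using a b by simp
  then have "n dvd b" using assms[of b] by (simp add: cong_0_iff)
  then have "d = 1" using b n_pos by (auto dest: dvd_imp_le)
  then show ?thesis unfolding d_def by (simp add: coprime_iff_gcd_eq_1)
qed

lemma isometry_imp_invariant:
  assumes f: "f \<in> Z2" and f': "f' \<in> Z2"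
    and iso: "hamming_isometries F C (crossed_product F C \<eta> f) (crossed_product F C \<eta> f') \<noteq> {}"
  obtains j :: nat and z where "coprime j n" "[j = 1] (mod s)"
    "[I f = (\<Sum>i<n. P ^ i) * z + int j * I f'] (mod T)"
proof -
  obtain \<psi> where
    \<psi>: "\<psi> \<in> hamming_isometries F C (crossed_product F C \<eta> f) (crossed_product F C \<eta> f')"
    using iso by blast
  have "\<exists>\<pi> \<gamma>. \<pi> \<in> hom C C \<and> inj_on \<pi> (carrier C) \<and>
      (\<forall>g\<in>carrier C. \<gamma> g \<in> Units F \<and> \<eta> (\<pi> g) = \<eta> g) \<and>
      (\<forall>g\<in>carrier C. \<forall>h\<in>carrier C.
        f (g, h) \<otimes>\<^bsub>F\<^esub> \<gamma> (g \<otimes>\<^bsub>C\<^esub> h) = \<gamma> g \<otimes>\<^bsub>F\<^esub> \<eta> g (\<gamma> h) \<otimes>\<^bsub>F\<^esub> f' (\<pi> g, \<pi> h))"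
    by (rule hamming_isometry_imp_data[OF field_F group_C finite_C \<eta>_hom f f' \<psi>]) blast
  then obtain \<pi> \<gamma> where \<pi>: "\<pi> \<in> hom C C" "inj_on \<pi> (carrier C)"
    and \<gamma>: "\<And>g. g \<in> carrier C \<Longrightarrow> \<gamma> g \<in> Units F"
    and \<eta>\<pi>: "\<And>g. g \<in> carrier C \<Longrightarrow> \<eta> (\<pi> g) = \<eta> g"
    and eq: "\<And>g h. g \<in> carrier C \<Longrightarrow> h \<in> carrier C \<Longrightarrow>
      f (g, h) \<otimes>\<^bsub>F\<^esub> \<gamma> (g \<otimes>\<^bsub>C\<^esub> h) = \<gamma> g \<otimes>\<^bsub>F\<^esub> \<eta> g (\<gamma> h) \<otimes>\<^bsub>F\<^esub> f' (\<pi> g, \<pi> h)"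
    by blast
  have "\<pi> \<sigma> \<in> carrier C" using \<pi>(1) \<sigma>_closed by (auto simp: hom_def)
  then obtain j where j: "\<pi> \<sigma> = u j" unfolding carrier_C by blast
  have \<pi>u: "\<pi> (u i) = u (i * j)" for i
    using hom_nat_pow[OF \<pi>(1) \<sigma>_closed group_C group_C, of i] j \<sigma>_closed
    by (simp add: C.nat_pow_pow mult.commute)
  have cop: "coprime j n"
  proof (rule coprime_of_inj)
    fix i assume "[i * j = 0] (mod n)"
    then have "\<pi> (u i) = \<pi> (u 0)" unfolding \<pi>u u_eq_iff by simp
    then have "u i = u 0" using \<pi>(2) by (simp only: inj_on_eq_iff u_closed)
    then show "[i = 0] (mod n)" by (simp only: u_eq_iff)
  qed
  have "\<eta> (u j) (E 1) = \<eta> (u 1) (E 1)"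
    using \<eta>\<pi>[OF \<sigma>_closed] j \<sigma>_closed by simp
  then have Pj: "[P ^ j = P] (mod T)"
    unfolding \<eta>_u E_eq_iff by simp
  then have js: "[j = 1] (mod s)"
    using power_cong_one_iff[OF P_ge_2 s_pos, of j 1] by (simp only: T_eq_power power_one_right)
  define c where "c i = dlog (\<gamma> (u i))" for i
  have Ec: "E (c i) = \<gamma> (u i)" for i
    unfolding c_def by (intro E_dlog \<gamma> u_closed)
  have step: "[L f i 1 + c (i + 1) = c i + P ^ i * c 1 + L f' (i * j) j] (mod T)" for i
  proof -
    have "E (L f i 1 + c (i + 1)) = E (c i + P ^ i * c 1 + L f' (i * j) j)"
      using eq[OF u_closed u_closed, of i 1] E_L[OF f] E_L[OF f'] Ec \<pi>u[of 1]
      by (simp only: E_add \<eta>_u[symmetric] u_add \<pi>u mult_1)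
    then show ?thesis by (simp only: E_eq_iff)
  qed
  have "[(\<Sum>i<n. L f i 1 + c (i + 1)) = (\<Sum>i<n. c i + P ^ i * c 1 + L f' (i * j) j)] (mod T)"
    using step by (intro cong_sum)
  moreover have "(\<Sum>i<n. L f i 1 + c (i + 1)) = (\<Sum>i<n. c i) + I f"
    using sum_periodic_shift[of c n 1] by (simp add: c_def sum.distrib I_def)
  moreover have "(\<Sum>i<n. c i + P ^ i * c 1 + L f' (i * j) j)
      = (\<Sum>i<n. c i) + ((\<Sum>i<n. P ^ i) * c 1 + (\<Sum>i<n. L f' (i * j) j))"
    by (simp add: sum.distrib sum_distrib_right)
  ultimately have 1: "[I f = (\<Sum>i<n. P ^ i) * c 1 + (\<Sum>i<n. L f' (i * j) j)] (mod T)"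
    by (simp only: cong_add_lcancel)
  obtain z where 2: "[(\<Sum>i<n. L f' (i * j) j) = (\<Sum>i<n. P ^ i) * z + int j * I f'] (mod T)"
    unfolding I_def using twisted_cocycle_pullback_invariant[OF L_cocycle[OF f'] L_periodic(1) Pj] by blast
  have "[I f = (\<Sum>i<n. P ^ i) * c 1 + ((\<Sum>i<n. P ^ i) * z + int j * I f')] (mod T)"
    by (rule cong_trans[OF 1 cong_add[OF cong_refl 2]])
  then show thesis
    using that[OF cop js, of "c 1 + z"] by (simp add: distrib_left add.assoc)
qed

lemma isometry_of_invariant:
  fixes j :: nat
  assumes f: "f \<in> Z2" and f': "f' \<in> Z2"
    and cop: "coprime j n" and js: "[j = 1] (mod s)"
    and z: "[I f = (\<Sum>i<n. P ^ i) * z + int j * I f'] (mod T)"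
  shows "hamming_isometries F C (crossed_product F C \<eta> f) (crossed_product F C \<eta> f') \<noteq> {}"
proof -
  have Pj: "[P ^ j = P] (mod T)"
    using js power_cong_one_iff[OF P_ge_2 s_pos, of j 1] by (simp only: T_eq_power power_one_right)
  have Pij: "[P ^ (i * j) = P ^ i] (mod T)" for i
    using cong_pow[OF Pj, of i] by (simp only: power_mult[symmetric] mult.commute)
  define d where "d = (\<lambda>a b. L f a b - L f' (a * j) (b * j))"
  have d: "twisted_cocycle T P d"
    unfolding twisted_cocycle_def
  proof (intro allI)
    fix a b l
    have 1: "[L f a b + L f (a + b) l = P ^ a * L f b l + L f a (b + l)] (mod T)"
      using L_cocycle[OF f] unfolding twisted_cocycle_def by blast
    have "[L f' (a * j) (b * j) + L f' (a * j + b * j) (l * j)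
        = P ^ (a * j) * L f' (b * j) (l * j) + L f' (a * j) (b * j + l * j)] (mod T)"
      using L_cocycle[OF f'] unfolding twisted_cocycle_def by blast
    also have "[P ^ (a * j) * L f' (b * j) (l * j) + L f' (a * j) (b * j + l * j)
        = P ^ a * L f' (b * j) (l * j) + L f' (a * j) (b * j + l * j)] (mod T)"
      using Pij by (intro cong_add cong_mult cong_refl)
    finally have 2: "[L f' (a * j) (b * j) + L f' (a * j + b * j) (l * j)
        = P ^ a * L f' (b * j) (l * j) + L f' (a * j) (b * j + l * j)] (mod T)" .
    show "[d a b + d (a + b) l = P ^ a * d b l + d a (b + l)] (mod T)"
      using cong_diff[OF 1 2] by (simp add: d_def algebra_simps)
  qed
  have per: "L f' (a + n * i) b = L f' a b" "L f' a (b + n * i) = L f' a b" for a b i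
    by (induction i) (simp_all add: L_periodic add.assoc[symmetric] add.commute[of n])
  have dper: "d (a + n) b = d a b" "d a (b + n) = d a b" for a b
    using per[of "a * j" j] per[of _ "b * j" j] by (simp_all add: d_def L_periodic distrib_right)
  obtain z' where z': "[(\<Sum>i<n. L f' (i * j) j) = (\<Sum>i<n. P ^ i) * z' + int j * I f'] (mod T)"
    unfolding I_def using twisted_cocycle_pullback_invariant[OF L_cocycle[OF f'] L_periodic(1) Pj] by blast
  have "(\<Sum>i<n. d i 1) = I f - (\<Sum>i<n. L f' (i * j) j)"
    by (simp add: d_def I_def sum_subtractf)
  also have "[\<dots> = (\<Sum>i<n. P ^ i) * (z - z')] (mod T)"
    using cong_diff[OF z z'] by (simp add: algebra_simps)
  finally have Id: "[(\<Sum>i<n. d i 1) = (\<Sum>i<n. P ^ i) * (z - z')] (mod T)" .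
  have "\<exists>c. (\<forall>i. [c (i + n) = c i] (mod T)) \<and> (\<forall>a b. [d a b = c a + P ^ a * c b - c (a + b)] (mod T))"
    by (rule twisted_cocycle_trivial[OF d dper Id]) blast
  then obtain c where cc:
    "(\<forall>i. [c (i + n) = c i] (mod T)) \<and> (\<forall>a b. [d a b = c a + P ^ a * c b - c (a + b)] (mod T))" ..
  have cper: "[c (i + n) = c i] (mod T)" for i
    using cc[THEN conjunct1] by (rule spec)
  have c: "[d a b = c a + P ^ a * c b - c (a + b)] (mod T)" for a b
    using cc[THEN conjunct2, THEN spec] by (rule spec)
  define \<gamma> where "\<gamma> g = E (c (idx g))" for g
  have \<gamma>u: "\<gamma> (u i) = E (c i)" for i
  proof -
    have "[c (a + n * l) = c a] (mod T)" for a l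
    proof (induction l)
      case (Suc l)
      have "[c (a + n * l + n) = c (a + n * l)] (mod T)" by (rule cper)
      then show ?case using Suc by (auto simp: ac_simps intro: cong_trans)
    qed simp
    then have "E (c (a + n * l)) = E (c a)" for a l
      by (simp only: E_eq_iff)
    moreover obtain a b where "i + a * n = idx (u i) + b * n"
      using idx_u[of i] unfolding cong_iff_lin_nat by blast
    ultimately show ?thesis unfolding \<gamma>_def by (metis mult.commute)
  qed
  define \<pi> where "\<pi> g = g [^]\<^bsub>C\<^esub> j" for g
  have \<pi>u: "\<pi> (u i) = u (i * j)" for i
    unfolding \<pi>_def using \<sigma>_closed by (rule C.nat_pow_pow)
  show ?thesis
  proof (rule hamming_isometry_of_data[OF field_F group_C finite_C \<eta>_hom f f'])
    show "\<pi> \<in> hom C C"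
    proof (rule homI)
      show "\<pi> g \<in> carrier C" if "g \<in> carrier C" for g
        using that by (simp add: \<pi>_def)
      show "\<pi> (g \<otimes>\<^bsub>C\<^esub> h) = \<pi> g \<otimes>\<^bsub>C\<^esub> \<pi> h" if "g \<in> carrier C" "h \<in> carrier C" for g h
        using that unfolding carrier_C by (auto simp only: u_add \<pi>u distrib_right)
    qed
    show "inj_on \<pi> (carrier C)"
      unfolding carrier_C
    proof (rule inj_onI, elim rangeE)
      fix x y a b assume *: "\<pi> x = \<pi> y" "x = u a" "y = u b"
      then have "[a * j = b * j] (mod n)" by (simp only: \<pi>u u_eq_iff)
      then show "x = y" using cop * by (simp only: cong_mult_rcancel_nat u_eq_iff)
    qed
    show "\<gamma> g \<in> Units F" for g by (simp add: \<gamma>_def)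
    show "\<eta> (\<pi> g) = \<eta> g" if "g \<in> carrier C" for g
    proof -
      obtain i where "g = u i" using \<open>g \<in> carrier C\<close> unfolding carrier_C by blast
      then show ?thesis using \<eta>_eqI[OF Pij, of i] by (simp only: \<pi>u)
    qed
    show "f (g, h) \<otimes>\<^bsub>F\<^esub> \<gamma> (g \<otimes>\<^bsub>C\<^esub> h) = \<gamma> g \<otimes>\<^bsub>F\<^esub> \<eta> g (\<gamma> h) \<otimes>\<^bsub>F\<^esub> f' (\<pi> g, \<pi> h)"
      if gh: "g \<in> carrier C" "h \<in> carrier C" for g h
    proof -
      obtain a b where ab: "g = u a" "h = u b" using gh unfolding carrier_C by blast
      have "[L f a b + c (a + b) = c a + P ^ a * c b + L f' (a * j) (b * j)] (mod T)"
        using c[of a b] by (simp add: d_def cong_iff_dvd_diff algebra_simps)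
      then have "E (L f a b + c (a + b)) = E (c a + P ^ a * c b + L f' (a * j) (b * j))"
        by (simp only: E_eq_iff)
      then show ?thesis
        unfolding ab by (simp only: E_add \<eta>_u[symmetric] u_add \<pi>u \<gamma>u E_L[OF f] E_L[OF f'])
    qed
  qed
qed

lemma M_dvd_I:
  assumes "f \<in> Z2"
  shows "M dvd I f"
proof -
  have "[P * I f = I f] (mod T)"
    unfolding I_def
    by (rule twisted_cocycle_invariant_fixed[OF L_cocycle[OF assms]]) (rule L_periodic)+
  then have "M * (P - 1) dvd I f * (P - 1)"
    unfolding T_eq[symmetric] by (simp add: cong_iff_dvd_diff algebra_simps)
  then show ?thesis using P_ge_2 by simp
qed

definition "J f = I f div M"

lemma I_eq: "f \<in> Z2 \<Longrightarrow> I f = M * J f"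
  unfolding J_def using M_dvd_I by simp

lemma modulus_eq: "int (modulus_m q n r k) = gcd (int t) (P - 1)"
proof -
  have "int (q ^ k - 1) = P - 1"
    using q_ge_2 by (simp add: P_def of_nat_diff)
  then show ?thesis
    unfolding modulus_m_def t_def by (subst gcd.commute) (metis gcd_int_int_eq)
qed

lemma invariant_cong_iff:
  "(\<exists>z. [M * a = (\<Sum>i<n. P ^ i) * z + M * b] (mod T)) \<longleftrightarrow> [a = b] (mod int (modulus_m q n r k))"
proof -
  have "[M * a = (\<Sum>i<n. P ^ i) * z + M * b] (mod T) \<longleftrightarrow> [int t * z = a - b] (mod (P - 1))" for z
  proof -
    have "[(\<Sum>i<n. P ^ i) * z + M * b = int t * M * z + M * b] (mod T)"
      using norm_exponent by (intro cong_add cong_mult cong_refl)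
    then have "[M * a = (\<Sum>i<n. P ^ i) * z + M * b] (mod T) \<longleftrightarrow> [int t * M * z + M * b = M * a] (mod T)"
      by (meson cong_sym cong_trans)
    also have "\<dots> \<longleftrightarrow> M * (P - 1) dvd M * (int t * z - (a - b))"
      by (simp add: cong_iff_dvd_diff T_eq algebra_simps)
    also have "\<dots> \<longleftrightarrow> [int t * z = a - b] (mod (P - 1))"
      using M_pos by (simp add: cong_iff_dvd_diff)
    finally show ?thesis .
  qed
  moreover have "(\<exists>z. [int t * z = a - b] (mod (P - 1))) \<longleftrightarrow> gcd (int t) (P - 1) dvd a - b"
  proof
    assume "\<exists>z. [int t * z = a - b] (mod (P - 1))"
    then obtain z where "P - 1 dvd int t * z - (a - b)"
      by (auto simp: cong_iff_dvd_diff)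
    then have "gcd (int t) (P - 1) dvd int t * z - (int t * z - (a - b))"
      by (intro dvd_diff[OF dvd_mult2[OF gcd_dvd1] dvd_trans[OF gcd_dvd2]])
    then show "gcd (int t) (P - 1) dvd a - b" by simp
  qed (rule cong_solve_dvd_int)
  ultimately show ?thesis by (simp add: modulus_eq cong_iff_dvd_diff)
qed

lemma isometry_iff:
  assumes f: "f \<in> Z2" and f': "f' \<in> Z2"
  shows "hamming_isometries F C (crossed_product F C \<eta> f) (crossed_product F C \<eta> f') \<noteq> {} \<longleftrightarrow>
    (\<exists>j::nat. coprime j n \<and> [j = 1] (mod s) \<and> [J f = int j * J f'] (mod int (modulus_m q n r k)))"
proof -
  have inv_iff: "(\<exists>z. [I f = (\<Sum>i<n. P ^ i) * z + int j * I f'] (mod T))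
      \<longleftrightarrow> [J f = int j * J f'] (mod int (modulus_m q n r k))" for j
    using invariant_cong_iff[of "J f" "int j * J f'"] I_eq[OF f] I_eq[OF f'] by (simp add: mult.left_commute)
  show ?thesis
  proof
    assume "hamming_isometries F C (crossed_product F C \<eta> f) (crossed_product F C \<eta> f') \<noteq> {}"
    then obtain j z where "coprime j n" "[j = 1] (mod s)"
      "[I f = (\<Sum>i<n. P ^ i) * z + int j * I f'] (mod T)"
      by (rule isometry_imp_invariant[OF f f'])
    then show "\<exists>j::nat. coprime j n \<and> [j = 1] (mod s) \<and> [J f = int j * J f'] (mod int (modulus_m q n r k))"
      using inv_iff by blast
  next
    assume "\<exists>j::nat. coprime j n \<and> [j = 1] (mod s) \<and> [J f = int j * J f'] (mod int (modulus_m q n r k))"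
    then obtain j :: nat and z where "coprime j n" "[j = 1] (mod s)"
      "[I f = (\<Sum>i<n. P ^ i) * z + int j * I f'] (mod T)"
      using inv_iff by blast
    then show "hamming_isometries F C (crossed_product F C \<eta> f) (crossed_product F C \<eta> f') \<noteq> {}"
      by (rule isometry_of_invariant[OF f f'])
  qed
qed

abbreviation "m \<equiv> modulus_m q n r k"

lemma m_pos: "m > 0"
  using modulus_eq t_pos by (metis gcd_pos_int of_nat_0_less_iff less_irrefl)

lemma s_dvd_n: "s dvd n" and t_dvd_n: "t dvd n"
  by (metis n_eq dvd_triv_right, metis n_eq dvd_triv_left)

lemma m_dvd_n: "m dvd n"
proof -
  have "int m dvd int t" unfolding modulus_eq by simp
  then have "m dvd t" by simp
  then show ?thesis using t_dvd_n by (rule dvd_trans)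
qed

lemma m_dvd_P: "int m dvd P - 1"
  unfolding modulus_eq by simp

lemma equiv_sim: "equiv (A_set q n r k) (sim_rel q n r k)"
proof (rule equivI)
  have sdn: "int s dvd int n" using s_dvd_n by simp
  have mdn: "int m dvd int n" using m_dvd_n by simp
  show "sim_rel q n r k \<subseteq> A_set q n r k \<times> A_set q n r k"
    by (auto simp: sim_rel_def)
  show "refl_on (A_set q n r k) (sim_rel q n r k)"
    by (rule refl_onI) (auto simp: sim_rel_def intro!: exI[of _ "1::int"])
  show "sym (sim_rel q n r k)"
  proof (rule symI)
    fix a b assume "(a, b) \<in> sim_rel q n r k"
    then obtain j where ab: "a \<in> A_set q n r k" "b \<in> A_set q n r k" and j: "coprime j (int n)"
      "[j = 1] (mod int s)" "[int a * j = int b] (mod int m)"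
      by (auto simp: sim_rel_def s_def)
    obtain i where i: "[j * i = 1] (mod int n)" using cong_solve_coprime_int[OF j(1)] ..
    have "[1 * i = j * i] (mod int s)" using j(2) by (intro cong_mult cong_refl) (rule cong_sym)
    also have "[j * i = 1] (mod int s)" using cong_dvd_modulus[OF i sdn] .
    finally have is1: "[i = 1] (mod int s)" by simp
    have "[int b * i = int a * j * i] (mod int m)" using j(3) by (intro cong_mult cong_refl) (rule cong_sym)
    also have "int a * j * i = int a * (j * i)" by simp
    also have "[int a * (j * i) = int a * 1] (mod int m)"
      using cong_dvd_modulus[OF i mdn] by (intro cong_mult cong_refl)
    finally have "[int b * i = int a] (mod int m)" by simp
    moreover have "coprime i (int n)"
      using i by (auto simp: coprime_iff_invertible_int mult.commute)
    ultimately show "(b, a) \<in> sim_rel q n r k"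
      using ab is1 by (auto simp: sim_rel_def s_def)
  qed
  show "trans (sim_rel q n r k)"
  proof (rule transI)
    fix a b c assume "(a, b) \<in> sim_rel q n r k" "(b, c) \<in> sim_rel q n r k"
    then obtain i j where abc: "a \<in> A_set q n r k" "c \<in> A_set q n r k"
      and i: "coprime i (int n)" "[i = 1] (mod int s)" "[int a * i = int b] (mod int m)"
      and j: "coprime j (int n)" "[j = 1] (mod int s)" "[int b * j = int c] (mod int m)"
      by (auto simp: sim_rel_def s_def)
    have "[int a * i * j = int b * j] (mod int m)" using i(3) by (intro cong_mult cong_refl)
    then have "[int a * (i * j) = int c] (mod int m)"
      using cong_trans[OF _ j(3)] by (simp add: mult.assoc)
    moreover have "[i * j = 1] (mod int s)" using cong_mult[OF i(2) j(2)] by simp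
    moreover have "coprime (i * j) (int n)" using i(1) j(1) by simp
    ultimately show "(a, c) \<in> sim_rel q n r k"
      using abc unfolding sim_rel_def s_def by blast
  qed
qed

lemma sim_rel_iff_nat:
  assumes "a \<in> A_set q n r k" "b \<in> A_set q n r k"
  shows "(a, b) \<in> sim_rel q n r k \<longleftrightarrow>
    (\<exists>j::nat. coprime j n \<and> [j = 1] (mod s) \<and> [int b = int j * int a] (mod int m))"
proof
  assume "(a, b) \<in> sim_rel q n r k"
  then obtain j where j: "coprime j (int n)" "[j = 1] (mod int s)" "[int a * j = int b] (mod int m)"
    by (auto simp: sim_rel_def s_def)
  define i where "i = nat (j mod int n)"
  have i: "int i = j mod int n" using n_pos by (simp add: i_def)
  then have ij: "[int i = j] (mod int n)" by simp
  have "[int i = j] (mod int s)" using ij by (rule cong_dvd_modulus) (simp add: s_dvd_n)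
  then have "[int i = int 1] (mod int s)" using cong_trans j(2) by auto
  then have "[i = 1] (mod s)" by (simp only: cong_int_iff)
  moreover have "coprime (int i) (int n)" using j(1) ij by (meson cong_imp_coprime cong_sym)
  then have "coprime i n" by simp
  moreover have "[int i = j] (mod int m)" using ij m_dvd_n by (auto intro: cong_dvd_modulus)
  then have "[int i * int a = j * int a] (mod int m)" by (rule cong_scalar_right)
  then have "[int b = int i * int a] (mod int m)"
    using j(3) by (metis cong_sym cong_trans mult.commute)
  ultimately show "\<exists>j::nat. coprime j n \<and> [j = 1] (mod s) \<and> [int b = int j * int a] (mod int m)"
    by blast
next
  assume "\<exists>j::nat. coprime j n \<and> [j = 1] (mod s) \<and> [int b = int j * int a] (mod int m)"
  then obtain j :: nat where j: "coprime j n" "[j = 1] (mod s)" "[int b = int j * int a] (mod int m)"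
    by blast
  have "coprime (int j) (int n)" "[int j = 1] (mod int s)" "[int a * int j = int b] (mod int m)"
    using j cong_int_iff[of j 1 s] by (simp_all add: cong_sym_eq mult.commute)
  then show "(a, b) \<in> sim_rel q n r k"
    using assms unfolding sim_rel_def s_def by blast
qed

lemma invariant_surj: "\<exists>f\<in>Z2. [J f = a] (mod int m)"
proof -
  \<comment> \<open>The usual carry cocycle, shifted so that its sum over \<open>i < n\<close> is \<open>1\<close> also when \<open>n = 1\<close>.\<close>
  define e :: "nat \<Rightarrow> nat \<Rightarrow> int" where
    "e i j = int ((i mod n + j mod n) div n) + int (1 div n)" for i j
  have e_alt: "e i j = int ((i + j) div n) - int (i div n) - int (j div n) + int (1 div n)" for i j
    unfolding e_def by (simp add: div_add1_eq[of i j n])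
  define f where "f = (\<lambda>x\<in>carrier C \<times> carrier C. E (M * a * e (idx (fst x)) (idx (snd x))))"
  have e_cong: "e i j = e i' j'" if "[i = i'] (mod n)" "[j = j'] (mod n)" for i j i' j'
    using that by (simp add: e_def cong_def)
  have fu: "f (u i, u j) = E (M * a * e i j)" for i j
    using e_cong[OF idx_u idx_u] by (simp add: f_def)
  have fixd: "E (P ^ i * (M * x)) = E (M * x)" for i x
  proof -
    have "[P = 1] (mod (P - 1))" by (simp add: cong_iff_dvd_diff)
    then have "P - 1 dvd P ^ i - 1"
      using cong_pow[of P 1 "P - 1" i] by (simp add: cong_iff_dvd_diff)
    then have "M * (P - 1) dvd M * x * (P ^ i - 1)"
      by (intro mult_dvd_mono) auto
    then show ?thesis
      unfolding E_eq_iff T_eq by (simp add: cong_iff_dvd_diff algebra_simps)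
  qed
  have f: "f \<in> Z2"
    unfolding two_cocycles_def
  proof (intro CollectI conjI ballI)
    show "f \<in> carrier C \<times> carrier C \<rightarrow>\<^sub>E Units F" by (simp add: f_def)
    fix g h l assume "g \<in> carrier C" "h \<in> carrier C" "l \<in> carrier C"
    then obtain i j b where ijb: "g = u i" "h = u j" "l = u b"
      unfolding carrier_C by blast
    have "e i j + e (i + j) b = e j b + e i (j + b)"
      by (simp add: e_alt add.assoc)
    then have "E (M * a * e i j + M * a * e (i + j) b) = E (M * a * e j b + M * a * e i (j + b))"
      by (simp only: distrib_left[symmetric])
    then show "f (g, h) \<otimes>\<^bsub>F\<^esub> f (g \<otimes>\<^bsub>C\<^esub> h, l) = \<eta> g (f (h, l)) \<otimes>\<^bsub>F\<^esub> f (g, h \<otimes>\<^bsub>C\<^esub> l)"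
      unfolding ijb by (simp only: u_add fu E_add \<eta>_u fixd mult.assoc)
  qed
  have "(\<Sum>i<n. e i 1) = 1"
  proof -
    have "(\<Sum>i<l. e i 1) = int (l div n)" for l
      by (induction l) (simp_all add: e_alt)
    then show ?thesis using n_pos by simp
  qed
  then have "(\<Sum>i<n. M * a * e i 1) = M * a"
    by (simp only: sum_distrib_left[symmetric] mult_1_right)
  moreover have "[L f i 1 = M * a * e i 1] (mod T)" for i
    using E_L[OF f, of i 1] fu[of i 1] by (simp only: E_eq_iff)
  then have "[I f = (\<Sum>i<n. M * a * e i 1)] (mod T)"
    unfolding I_def by (intro cong_sum)
  ultimately have "[M * J f = M * a] (mod T)"
    using I_eq[OF f] by simp
  then have "M * (P - 1) dvd M * (J f - a)"
    unfolding T_eq by (simp add: cong_iff_dvd_diff right_diff_distrib)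
  then have "[J f = a] (mod (P - 1))"
    using M_pos by (simp add: cong_iff_dvd_diff)
  then show ?thesis
    using cong_dvd_modulus[OF _ m_dvd_P] f by blast
qed

definition "repr x = nat ((x - 1) mod int m) + 1"

lemma repr: "repr x \<in> A_set q n r k" "[int (repr x) = x] (mod int m)"
proof -
  have 1: "int (repr x) = (x - 1) mod int m + 1"
    using m_pos by (simp add: repr_def)
  have "(x - 1) mod int m < int m" "0 \<le> (x - 1) mod int m" using m_pos by auto
  then have "1 \<le> int (repr x)" "int (repr x) \<le> int m" unfolding 1 by linarith+
  then show "repr x \<in> A_set q n r k" by (simp add: A_set_def)
  have "[(x - 1) mod int m + 1 = x - 1 + 1] (mod int m)"
    by (intro cong_add cong_refl) simp
  then show "[int (repr x) = x] (mod int m)" unfolding 1 by simp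
qed

lemma classes_bij:
  "\<exists>\<Phi>. bij_betw \<Phi> (hamming_isometry_classes F C \<eta>) (A_set q n r k // sim_rel q n r k)"
proof -
  define fc where "fc A = (SOME f. f \<in> Z2 \<and> crossed_product F C \<eta> f = A)" for A
  have fc: "fc A \<in> Z2" "crossed_product F C \<eta> (fc A) = A" if "A \<in> crossed_products F C \<eta>" for A
  proof -
    have "\<exists>f. f \<in> Z2 \<and> crossed_product F C \<eta> f = A"
      using that by (auto simp: crossed_products_def)
    then have "fc A \<in> Z2 \<and> crossed_product F C \<eta> (fc A) = A"
      unfolding fc_def by (rule someI_ex)
    then show "fc A \<in> Z2" "crossed_product F C \<eta> (fc A) = A" by auto
  qed
  have eqv: "equiv (crossed_products F C \<eta>) (isometry_rel F C \<eta>)"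
    by (rule equiv_isometry_rel[OF F.is_cring group_C \<eta>_hom])
  have rel: "(crossed_product F C \<eta> f, crossed_product F C \<eta> f') \<in> isometry_rel F C \<eta> \<longleftrightarrow>
      (\<exists>j::nat. coprime j n \<and> [j = 1] (mod s) \<and> [J f = int j * J f'] (mod int m))"
    if "f \<in> Z2" "f' \<in> Z2" for f f'
    unfolding isometry_iff[OF that, symmetric] using that
    by (auto simp: isometry_rel_def crossed_products_def)
  define h where "h A = repr (J (fc A))" for A
  have sim: "(repr x, repr y) \<in> sim_rel q n r k \<longleftrightarrow>
      (\<exists>j::nat. coprime j n \<and> [j = 1] (mod s) \<and> [y = int j * x] (mod int m))" for x y
  proof -
    have "[int (repr y) = int j * int (repr x)] (mod int m) \<longleftrightarrow> [y = int j * x] (mod int m)" for j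
      using repr(2)[of y] cong_scalar_left[OF repr(2)[of x], of "int j"] by (meson cong_sym cong_trans)
    then show ?thesis by (simp add: sim_rel_iff_nat[OF repr(1) repr(1)])
  qed
  show ?thesis
    unfolding hamming_isometry_classes_def
  proof (rule quotient_bij_betw[OF eqv equiv_sim, where h = h])
    show "h A \<in> A_set q n r k" for A by (simp add: h_def repr)
    show "(A, B) \<in> isometry_rel F C \<eta> \<longleftrightarrow> (h A, h B) \<in> sim_rel q n r k"
      if "A \<in> crossed_products F C \<eta>" "B \<in> crossed_products F C \<eta>" for A B
    proof -
      have "(A, B) \<in> isometry_rel F C \<eta> \<longleftrightarrow> (B, A) \<in> isometry_rel F C \<eta>"
        using equivE[OF eqv] by (meson symD)
      also have "\<dots> \<longleftrightarrow> (h A, h B) \<in> sim_rel q n r k"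
        using rel[OF fc(1)[OF that(2)] fc(1)[OF that(1)]]
        by (simp only: fc(2)[OF that(1)] fc(2)[OF that(2)] h_def sim)
      finally show ?thesis .
    qed
    show "\<exists>A\<in>crossed_products F C \<eta>. (h A, y) \<in> sim_rel q n r k" if y: "y \<in> A_set q n r k" for y
    proof -
      obtain f where f: "f \<in> Z2" "[J f = int y] (mod int m)" using invariant_surj by blast
      let ?A = "crossed_product F C \<eta> f"
      have A: "?A \<in> crossed_products F C \<eta>" using f(1) by (simp add: crossed_products_def)
      have "(?A, crossed_product F C \<eta> (fc ?A)) \<in> isometry_rel F C \<eta>"
        unfolding fc(2)[OF A] using eqv A by (meson equivE refl_onD)
      then obtain j :: nat where j: "coprime j n" "[j = 1] (mod s)" "[J f = int j * J (fc ?A)] (mod int m)"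
        unfolding rel[OF f(1) fc(1)[OF A]] by blast
      have "[int j * int (h ?A) = int j * J (fc ?A)] (mod int m)"
        unfolding h_def by (rule cong_scalar_left[OF repr(2)])
      then have "[int y = int j * int (h ?A)] (mod int m)"
        using j(3) f(2) by (meson cong_sym cong_trans)
      then have "(h ?A, y) \<in> sim_rel q n r k"
        using j(1,2) y by (subst sim_rel_iff_nat) (auto simp: h_def repr)
      then show ?thesis using A by blast
    qed
  qed
qed

end

theorem theorem3p3:
  fixes q n r k :: nat
    and F :: "('a, 'm) ring_scheme"
    and C :: "('g, 'l) monoid_scheme"
    and \<sigma> :: 'g
    and \<eta> :: "'g \<Rightarrow> 'a \<Rightarrow> 'a"
  assumes "Factorial_Ring.prime q"
    and "n > 0" and "r > 0" and "k > 0"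
    and "k dvd r" and "r div k dvd n"
    and "field F" and "order F = q ^ r"
    and "group C" and "\<sigma> \<in> carrier C" and "generate C {\<sigma>} = carrier C" and "order C = n"
    and "\<eta> \<in> hom C (RingAutoGroup F)"
    and "\<eta> \<sigma> = frobenius_map F q [^]\<^bsub>RingAutoGroup F\<^esub> k"
  shows "equiv (A_set q n r k) (sim_rel q n r k) \<and>
    (\<exists>\<Phi>. bij_betw \<Phi> (hamming_isometry_classes F C \<eta>) (A_set q n r k // sim_rel q n r k))"
proof -
  interpret cyclic_action q n r k F C \<sigma> \<eta>
    using assms by (rule cyclic_action.intro)
  show ?thesis
    using equiv_sim classes_bij by blast
qed

end
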